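(* Let $d\ge 3$ and let $E=(e_{ij})_{1\le i,j\le d}$ be partitioned as $E=(E_{ij})_{1\le i,j\le 3}$ with diagonal blocks of sizes $d-2,1,1$, so that $E_{11}=(e_{ij})_{1\le i,j\le d-2}$. The restriction of the morphisms $j_n$, $n\ge 1$, to the subalgebra $$\Big\langle \mathbf{Tr}(E_{11}^k),\ \mathbf{Tr}\Big(\begin{bmatrix} E_{11} & E_{12} \\ E_{21} & E_{22} \end{bmatrix}^k\Big),\ \mathbf{Tr}(E^k),\ k\in\mathbb N\Big\rangle$$ of $\mathcal U(\mathfrak g)$ does not define a quantum Markov process.
   Context: $\mathfrak g=\operatorname{M}_d(\mathbb C)$ is the Lie algebra of $G=\operatorname{GL}_d(\mathbb C)$, with matrix units $e_{ij}$; $\mathcal U(\mathfrak g)$ is its universal enveloping algebra (the unital associative algebra generated by the $e_{ij}$ with relations $[e_{ij},e_{kl}]=\delta_{jk}e_{il}-\delta_{il}e_{kj}$), with unit $1$; $I=\sum_i e_{ii}\in\mathfrak g$ is the identity matrix and $h_i=e_{ii}-e_{i+1\,i+1}$. The coproduct $\Delta:\mathcal U(\mathfrak g)\to\mathcal U(\mathfrak g)\otimes\mathcal U(\mathfrak g)$ is the unital algebra homomorphism with $\Delta(I)=I\otimes I$, $\Delta(e_{ij})=1\otimes e_{ij}+e_{ij}\otimes 1$ for $i\neq j$, and $\Delta(h_i)=1\otimes h_i+h_i\otimes 1$ for $1\le i\le d-1$. $\rho$ is the standard representation of $\mathfrak g$ on $\mathbb C^d$, extended to $\mathcal U(\mathfrak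 g)$; $\rho^{\otimes 1}=\rho$ and $\rho^{\otimes n}(x)=(\rho^{\otimes n-1}\otimes\rho)\Delta(x)$. $\operatorname{tr}=\frac1d\operatorname{Tr}$ is the normalized trace on $\operatorname{M}_d(\mathbb C)$, and $\mathcal W=\operatorname{M}_d(\mathbb C)^{\otimes\infty}$ is the infinite tensor product in the sense of von Neumann algebras with respect to the product state $\omega=\operatorname{tr}^{\otimes\infty}$; $\operatorname{M}_d(\mathbb C)^{\otimes n}$ is embedded in $\mathcal W$ by $a\mapsto a\otimes I^{\otimes\infty}$. The morphism $j_n:\mathcal U(\mathfrak g)\to\mathcal W$ is $j_n(x)=\rho^{\otimes n}(x)$. Let $\eta(x)=\operatorname{tr}(\rho(x))$ and $P=(\mathrm{id}\otimes\eta)\circ\Delta:\mathcal U(\mathfrak g)\to\mathcal U(\mathfrak g)$. For a subalgebra $\mathcal B\subset\mathcal U(\mathfrak g)$, "the restriction of the $j_n$'s to $\mathcal B$ defines a quantum Markov process (chain)" means that $P\mathcal B\subset\mathcal B$, so that $P|_{\mathcal B}$ is a transition operator on $\mathcal B$: for all $n\ge 2$, $x\in\mathcal B$ and $\xi$ in the von Neumann algebra generated by $\{j_k(\mathcal B),k\le n-1\}$, one has $\omega(j_n(x)\xi)=\omega(j_{n-1}(Px)\xi)$ with $Px\in\mathcal B$. Thus the failure of this property means that $P\mathcal B\not\subset\mathcal B$. Matrices with entries in $\mathcal U(\mathfrak g)$ are added and multiplied by the usual rules, and for a square matrix $M=(m_{ij})$ with entries in $\mathcal U(\mathfrak g)$,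 $\mathbf{Tr}(M)=\sum_i m_{ii}\in\mathcal U(\mathfrak g)$. $\langle a_1,a_2,\dots\rangle$ denotes the subalgebra of $\mathcal U(\mathfrak g)$ generated by the constants and $a_1,a_2,\dots$. *)

theory Defs
  imports "HOL-Analysis.Determinants" "HOL-Library.Poly_Mapping"
begin

section \<open>Unital complex algebras\<close>

class complex_algebra_1 = ring_1 +
  fixes scaleC :: "complex \<Rightarrow> 'a \<Rightarrow> 'a"  (infixr "*\<^sub>C" 75)
  assumes scaleC_add_right: "c *\<^sub>C (x + y) = c *\<^sub>C x + c *\<^sub>C y"
    and scaleC_add_left: "(c + c') *\<^sub>C x = c *\<^sub>C x + c' *\<^sub>C x"
    and scaleC_scaleC: "c *\<^sub>C c' *\<^sub>C x = (c * c') *\<^sub>C x"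
    and scaleC_one: "1 *\<^sub>C x = x"
    and mult_scaleC_left: "(c *\<^sub>C x) * y = c *\<^sub>C (x * y)"
    and mult_scaleC_right: "x * (c *\<^sub>C y) = c *\<^sub>C (x * y)"

lemma scaleC_zero_left [simp]: "0 *\<^sub>C (x::'a::complex_algebra_1) = 0"
  using scaleC_add_left[of 0 0 x] by simp

lemma scaleC_zero_right [simp]: "c *\<^sub>C (0::'a::complex_algebra_1) = 0"
  using scaleC_add_right[of c 0 "0::'a"] by simp

lemma scaleC_minus_left: "(- c) *\<^sub>C (x::'a::complex_algebra_1) = - (c *\<^sub>C x)"
  using scaleC_add_left[of c "- c" x] by (simp add: add_eq_0_iff)

lemma scaleC_minus_right: "c *\<^sub>C (- x) = - (c *\<^sub>C (x::'a::complex_algebra_1))"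
  using scaleC_add_right[of c x "- x"] by (simp add: add_eq_0_iff)

lemma scaleC_diff_right: "c *\<^sub>C (x - y) = c *\<^sub>C x - c *\<^sub>C (y::'a::complex_algebra_1)"
  using scaleC_add_right[of c x "- y"] by (simp add: scaleC_minus_right)

lemma scaleC_sum_right: "c *\<^sub>C sum f S = (\<Sum>i\<in>S. c *\<^sub>C (f i :: 'a::complex_algebra_1))"
  by (induction S rule: infinite_finite_induct) (simp_all add: scaleC_add_right)

lemma scaleC_of_nat: "of_nat n *\<^sub>C (x::'a::complex_algebra_1) = of_nat n * x"
  by (induction n) (simp_all add: scaleC_add_left scaleC_one distrib_right)

instantiation complex :: complex_algebra_1
begin
definition scaleC_complex_def [simp]: "scaleC c z = c * (z::complex)"
instance by standard (simp_all add: algebra_simps)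
end

definition unital_algebra_hom :: "('a::complex_algebra_1 \<Rightarrow> 'b::complex_algebra_1) \<Rightarrow> bool" where
  "unital_algebra_hom f \<longleftrightarrow>
     f 1 = 1 \<and> (\<forall>x y. f (x + y) = f x + f y) \<and> (\<forall>x y. f (x * y) = f x * f y) \<and>
     (\<forall>c x. f (c *\<^sub>C x) = c *\<^sub>C f x)"

inductive_set generated_subalgebra :: "'a::complex_algebra_1 set \<Rightarrow> 'a set" for S where
  const: "c *\<^sub>C 1 \<in> generated_subalgebra S"
| gen: "x \<in> S \<Longrightarrow> x \<in> generated_subalgebra S"
| plus: "x \<in> generated_subalgebra S \<Longrightarrow> y \<in> generated_subalgebra S \<Longrightarrow>
           x + y \<in> generated_subalgebra S"
| times: "x \<in> generated_subalgebra S \<Longrightarrow> y \<in> generated_subalgebra S \<Longrightarrow>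
           x * y \<in> generated_subalgebra S"


section \<open>Monoid algebras over the complex numbers\<close>

text \<open>
  For an additively written, possibly non-commutative monoid \<open>'m\<close>, the type \<open>'m \<Rightarrow>\<^sub>0 complex\<close>
  with its convolution product is the monoid algebra. The element \<open>single 0 c\<close> is the scalar \<open>c\<close>,
  so \<open>single 0 c * p\<close> is the scalar multiple of \<open>p\<close>.
\<close>

lemma pm_induct [case_names zero single add]:
  fixes p :: "'m \<Rightarrow>\<^sub>0 complex"
  assumes "P 0" "\<And>m c. P (Poly_Mapping.single m c)" "\<And>p q. P p \<Longrightarrow> P q \<Longrightarrow> P (p + q)"
  shows "P p"
proof (induction p rule: update_induct)
  case const
  show ?case using assms(1) by simp
next
  case (update f a b)
  have "Poly_Mapping.update a b f = f + Poly_Mapping.single a b"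
    using update(1) by (intro poly_mapping_eqI)
      (auto simp: lookup_update lookup_add lookup_single when_def in_keys_iff)
  then show ?case using assms update by simp
qed

definition lin_ext :: "('m \<Rightarrow> 'a::complex_algebra_1) \<Rightarrow> ('m \<Rightarrow>\<^sub>0 complex) \<Rightarrow> 'a" where
  "lin_ext g p = (\<Sum>m\<in>Poly_Mapping.keys p. Poly_Mapping.lookup p m *\<^sub>C g m)"

lemma lin_ext_zero [simp]: "lin_ext g 0 = 0"
  by (simp add: lin_ext_def)

lemma lin_ext_single [simp]: "lin_ext g (Poly_Mapping.single m c) = c *\<^sub>C g m"
  by (simp add: lin_ext_def)

lemma lin_ext_add: "lin_ext g (p + q) = lin_ext g p + lin_ext g q"
  unfolding lin_ext_def
  by (rule setsum_keys_plus_distrib) (simp_all add: scaleC_add_left)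

lemma lin_ext_uminus: "lin_ext g (- p) = - lin_ext g p"
  using lin_ext_add[of g p "- p"] by (simp add: add_eq_0_iff)

lemma lin_ext_diff: "lin_ext g (p - q) = lin_ext g p - lin_ext g q"
  using lin_ext_add[of g p "- q"] by (simp add: lin_ext_uminus)

lemma lin_ext_scale:
  fixes p :: "'m::monoid_add \<Rightarrow>\<^sub>0 complex"
  shows "lin_ext g (Poly_Mapping.single 0 c * p) = c *\<^sub>C lin_ext g p"
  by (induction p rule: pm_induct)
     (simp_all add: mult_single distrib_left lin_ext_add scaleC_add_right scaleC_scaleC)

lemma lin_ext_mult:
  fixes p q :: "'m::monoid_add \<Rightarrow>\<^sub>0 complex"
  assumes g: "\<And>m n. g (m + n) = g m * g n"
  shows "lin_ext g (p * q) = lin_ext g p * lin_ext g q"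
proof (induction p rule: pm_induct)
  case (single m c)
  show ?case
    by (induction q rule: pm_induct)
       (simp_all add: mult_single g distrib_left lin_ext_add mult_scaleC_left mult_scaleC_right
          scaleC_scaleC scaleC_add_right mult.commute)
qed (simp_all add: lin_ext_add distrib_right)

lemma single_zero_central:
  fixes p :: "'m::monoid_add \<Rightarrow>\<^sub>0 complex"
  shows "p * Poly_Mapping.single 0 c = Poly_Mapping.single 0 c * p"
  by (induction p rule: pm_induct) (simp_all add: mult_single algebra_simps)


section \<open>The enveloping algebra of the general linear Lie algebra\<close>

text \<open>
  Words over an alphabet, written additively because \<^theory>\<open>HOL-Library.Poly_Mapping\<close> takes the
  exponent monoid to be additive; thus \<open>'g words \<Rightarrow>\<^sub>0 complex\<close> is the free associative unital algebra
  on \<open>'g\<close>.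
\<close>

datatype 'g words = Word (letters: "'g list")

instantiation words :: (type) monoid_add
begin
definition "0 = Word []"
definition "v + w = Word (letters v @ letters w)"
instance by standard (simp_all add: zero_words_def plus_words_def)
end

abbreviation letter :: "'g \<Rightarrow> 'g words \<Rightarrow>\<^sub>0 complex" where
  "letter a \<equiv> Poly_Mapping.single (Word [a]) 1"

text \<open>
  The index set \<open>{1, \<dots>, d}\<close> is a finite linearly ordered type \<open>'d\<close>, with \<open>d = CARD('d)\<close>.
\<close>

definition gl_relator :: "'d \<Rightarrow> 'd \<Rightarrow> 'd \<Rightarrow> 'd \<Rightarrow> ('d \<times> 'd) words \<Rightarrow>\<^sub>0 complex" where
  "gl_relator i j k l =
     letter (i, j) * letter (k, l) - letter (k, l) * letter (i, j)
     - ((if j = k then letter (i, l) else 0) - (if i = l then letter (k, j) else 0))"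

inductive_set gl_ideal :: "(('d \<times> 'd) words \<Rightarrow>\<^sub>0 complex) set" where
  zero: "0 \<in> gl_ideal"
| rel: "a * gl_relator i j k l * b \<in> gl_ideal"
| plus: "p \<in> gl_ideal \<Longrightarrow> q \<in> gl_ideal \<Longrightarrow> p + q \<in> gl_ideal"

lemma gl_ideal_mult_left: "p \<in> gl_ideal \<Longrightarrow> a * p \<in> gl_ideal"
proof (induction rule: gl_ideal.induct)
  case (rel b i j k l c)
  then show ?case using gl_ideal.rel[of "a * b" i j k l c] by (simp add: mult.assoc)
qed (auto simp: distrib_left intro: gl_ideal.intros)

lemma gl_ideal_mult_right: "p \<in> gl_ideal \<Longrightarrow> p * a \<in> gl_ideal"
proof (induction rule: gl_ideal.induct)
  case (rel b i j k l c)
  then show ?case using gl_ideal.rel[of b i j k l "c * a"] by (simp add: mult.assoc)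
qed (auto simp: distrib_right intro: gl_ideal.intros)

lemma gl_ideal_uminus: "p \<in> gl_ideal \<Longrightarrow> - p \<in> gl_ideal"
  using gl_ideal_mult_left[of p "- 1"] by simp

lemma gl_ideal_diff: "p \<in> gl_ideal \<Longrightarrow> q \<in> gl_ideal \<Longrightarrow> p - q \<in> gl_ideal"
  using gl_ideal.plus[OF _ gl_ideal_uminus] by fastforce

quotient_type 'd Ugl = "('d \<times> 'd) words \<Rightarrow>\<^sub>0 complex" / "\<lambda>p q. p - q \<in> gl_ideal"
proof (rule equivpI)
  show "reflp (\<lambda>p q :: ('d \<times> 'd) words \<Rightarrow>\<^sub>0 complex. p - q \<in> gl_ideal)"
    by (simp add: reflp_def gl_ideal.zero)
  show "symp (\<lambda>p q :: ('d \<times> 'd) words \<Rightarrow>\<^sub>0 complex. p - q \<in> gl_ideal)"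
  proof (rule sympI)
    fix p q :: "('d \<times> 'd) words \<Rightarrow>\<^sub>0 complex"
    assume "p - q \<in> gl_ideal"
    from gl_ideal_uminus[OF this] show "q - p \<in> gl_ideal" by simp
  qed
  show "transp (\<lambda>p q :: ('d \<times> 'd) words \<Rightarrow>\<^sub>0 complex. p - q \<in> gl_ideal)"
  proof (rule transpI)
    fix p q r :: "('d \<times> 'd) words \<Rightarrow>\<^sub>0 complex"
    assume "p - q \<in> gl_ideal" "q - r \<in> gl_ideal"
    from gl_ideal.plus[OF this] show "p - r \<in> gl_ideal" by simp
  qed
qed

instantiation Ugl :: (type) complex_algebra_1
begin

lift_definition zero_Ugl :: "'a Ugl" is 0 .
lift_definition one_Ugl :: "'a Ugl" is 1 .
lift_definition plus_Ugl :: "'a Ugl \<Rightarrow> 'a Ugl \<Rightarrow> 'a Ugl" is "(+)"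
  by (metis add_diff_add gl_ideal.plus)
lift_definition uminus_Ugl :: "'a Ugl \<Rightarrow> 'a Ugl" is uminus
  by (metis gl_ideal_uminus minus_diff_minus)
lift_definition minus_Ugl :: "'a Ugl \<Rightarrow> 'a Ugl \<Rightarrow> 'a Ugl" is "(-)"
proof -
  fix p p' q q' :: "('a \<times> 'a) words \<Rightarrow>\<^sub>0 complex"
  assume "p - p' \<in> gl_ideal" "q - q' \<in> gl_ideal"
  from gl_ideal_diff[OF this] show "(p - q) - (p' - q') \<in> gl_ideal"
    by (simp add: algebra_simps)
qed
lift_definition times_Ugl :: "'a Ugl \<Rightarrow> 'a Ugl \<Rightarrow> 'a Ugl" is "(*)"
proof -
  fix p p' q q' :: "('a \<times> 'a) words \<Rightarrow>\<^sub>0 complex"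
  assume "p - p' \<in> gl_ideal" "q - q' \<in> gl_ideal"
  then have "(p - p') * q + p' * (q - q') \<in> gl_ideal"
    by (intro gl_ideal.plus gl_ideal_mult_left gl_ideal_mult_right)
  then show "p * q - p' * q' \<in> gl_ideal"
    by (simp add: algebra_simps)
qed
lift_definition scaleC_Ugl :: "complex \<Rightarrow> 'a Ugl \<Rightarrow> 'a Ugl"
  is "\<lambda>c p. Poly_Mapping.single 0 c * p"
  by (metis gl_ideal_mult_left right_diff_distrib)

instance
proof
  have one_neq: "(1 :: ('a \<times> 'a) words \<Rightarrow>\<^sub>0 complex) - 0 \<notin> gl_ideal"
  proof
    have g: "lin_ext (\<lambda>w. if letters w = [] then 1 else (0::complex)) p = 0"
      if "p \<in> gl_ideal" for p :: "('a \<times> 'a) words \<Rightarrow>\<^sub>0 complex"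
      using that
    proof induction
      case (rel a i j k l b)
      then show ?case
        by (subst lin_ext_mult, simp add: plus_words_def)+
           (simp add: gl_relator_def lin_ext_diff mult_single plus_words_def)
    qed (simp_all add: lin_ext_add)
    assume "(1 :: ('a \<times> 'a) words \<Rightarrow>\<^sub>0 complex) - 0 \<in> gl_ideal"
    from g[OF this] show False
      by (simp add: zero_words_def flip: single_one)
  qed
  show "(0 :: 'a Ugl) \<noteq> 1"
    by transfer (metis one_neq gl_ideal_uminus minus_diff_eq)
next
  fix c c' :: complex and x y z :: "'a Ugl"
  show "x * y * z = x * (y * z)" by transfer (simp add: mult.assoc gl_ideal.zero)
  show "1 * x = x" "x * 1 = x" by (transfer; simp add: gl_ideal.zero)+
  show "x + y + z = x + (y + z)" by transfer (simp add: add.assoc gl_ideal.zero)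
  show "x + y = y + x" by transfer (simp add: add.commute gl_ideal.zero)
  show "0 + x = x" by transfer (simp add: gl_ideal.zero)
  show "- x + x = 0" by transfer (simp add: gl_ideal.zero)
  show "x - y = x + - y" by transfer (simp add: gl_ideal.zero)
  show "(x + y) * z = x * z + y * z" by transfer (simp add: distrib_right gl_ideal.zero)
  show "x * (y + z) = x * y + x * z" by transfer (simp add: distrib_left gl_ideal.zero)
  show "c *\<^sub>C (x + y) = c *\<^sub>C x + c *\<^sub>C y" by transfer (simp add: distrib_left gl_ideal.zero)
  show "(c + c') *\<^sub>C x = c *\<^sub>C x + c' *\<^sub>C x"
    by transfer (simp add: single_add distrib_right gl_ideal.zero)
  show "c *\<^sub>C c' *\<^sub>C x = (c * c') *\<^sub>C x"
    by transfer (simp add: mult_single gl_ideal.zero flip: mult.assoc)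
  show "1 *\<^sub>C x = x" by transfer (simp add: gl_ideal.zero)
  show "(c *\<^sub>C x) * y = c *\<^sub>C (x * y)" by transfer (simp add: mult.assoc gl_ideal.zero)
  show "x * (c *\<^sub>C y) = c *\<^sub>C (x * y)"
  proof transfer
    fix c and p q :: "('a \<times> 'a) words \<Rightarrow>\<^sub>0 complex"
    have "p * (Poly_Mapping.single 0 c * q) = Poly_Mapping.single 0 c * (p * q)"
      by (simp only: mult.assoc[symmetric] single_zero_central)
    then show "p * (Poly_Mapping.single 0 c * q) - Poly_Mapping.single 0 c * (p * q) \<in> gl_ideal"
      by (simp add: gl_ideal.zero)
  qed
qed

end

lift_definition gl_e :: "'d \<Rightarrow> 'd \<Rightarrow> 'd Ugl" is "\<lambda>i j. letter (i, j)" .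

lemma gl_e_commutator:
  "gl_e i j * gl_e k l - gl_e k l * gl_e i j =
     (if j = k then gl_e i l else 0) - (if i = l then gl_e k j else 0)"
proof -
  have if_abs: "(if b then abs_Ugl p else 0) = abs_Ugl (if b then p else 0)"
    for b and p :: "('a \<times> 'a) words \<Rightarrow>\<^sub>0 complex"
    by (simp add: zero_Ugl.abs_eq)
  have "gl_relator i j k l \<in> gl_ideal"
    using gl_ideal.rel[of 1 i j k l 1] by simp
  then show ?thesis
    unfolding gl_e.abs_eq if_abs times_Ugl.abs_eq minus_Ugl.abs_eq Ugl.abs_eq_iff gl_relator_def .
qed

definition I_gl :: "'d::finite Ugl" where
  "I_gl = (\<Sum>i\<in>UNIV. gl_e i i)"

lemma Ugl_generated: "u \<in> generated_subalgebra (range (\<lambda>(i, j). gl_e i j))"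
proof -
  have letters: "abs_Ugl (Poly_Mapping.single (Word as) 1)
      \<in> generated_subalgebra (range (\<lambda>(i, j). gl_e i j))" for as :: "('a \<times> 'a) list"
  proof (induction as)
    case Nil
    have "abs_Ugl (Poly_Mapping.single (Word ([] :: ('a \<times> 'a) list)) 1) = 1"
      by (metis one_Ugl.abs_eq single_one zero_words_def)
    then show ?case
      using generated_subalgebra.const[of 1] by (simp add: scaleC_one)
  next
    case (Cons a as)
    have "Poly_Mapping.single (Word (a # as)) 1 =
        letter a * Poly_Mapping.single (Word as) (1::complex)"
      by (simp add: mult_single plus_words_def)
    then have "abs_Ugl (Poly_Mapping.single (Word (a # as)) 1) =
        gl_e (fst a) (snd a) * abs_Ugl (Poly_Mapping.single (Word as) 1)"
      by (simp add: times_Ugl.abs_eq gl_e.abs_eq)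
    moreover have "gl_e (fst a) (snd a) \<in> range (\<lambda>(i, j). gl_e i j)"
      by (rule range_eqI[of _ _ a]) (simp add: split_beta)
    ultimately show ?case
      using Cons by (simp add: generated_subalgebra.times generated_subalgebra.gen)
  qed
  have "abs_Ugl p \<in> generated_subalgebra (range (\<lambda>(i, j). gl_e i j))"
    for p :: "('a \<times> 'a) words \<Rightarrow>\<^sub>0 complex"
  proof (induction p rule: pm_induct)
    case zero
    show ?case using generated_subalgebra.const[of 0] by (simp add: flip: zero_Ugl.abs_eq)
  next
    case (single m c)
    obtain as where m: "m = Word as" by (cases m)
    have "Poly_Mapping.single m c = Poly_Mapping.single 0 c * Poly_Mapping.single (Word as) 1"
      by (simp add: mult_single m)
    then have "abs_Ugl (Poly_Mapping.single m c) =
        (c *\<^sub>C 1) * abs_Ugl (Poly_Mapping.single (Word as) 1)"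
      by (simp add: mult_scaleC_left scaleC_Ugl.abs_eq)
    then show ?case
      using letters by (auto intro: generated_subalgebra.times generated_subalgebra.const)
  next
    case (add p q)
    then show ?case by (auto simp: plus_Ugl.abs_eq[symmetric] intro: generated_subalgebra.plus)
  qed
  then show ?thesis by (rule Ugl.abs_induct)
qed

lemma unital_algebra_hom_eqI:
  fixes f g :: "'d Ugl \<Rightarrow> 'b::complex_algebra_1"
  assumes f: "unital_algebra_hom f" and g: "unital_algebra_hom g"
    and eq: "\<And>i j. f (gl_e i j) = g (gl_e i j)"
  shows "f = g"
proof
  fix u
  show "f u = g u"
    using Ugl_generated[of u] f g eq
    by (induction) (auto simp: unital_algebra_hom_def)
qed

definition Ugl_lift :: "('d \<Rightarrow> 'd \<Rightarrow> 'b::complex_algebra_1) \<Rightarrow> 'd Ugl \<Rightarrow> 'b" where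
  "Ugl_lift \<phi> u = lin_ext (\<lambda>w. prod_list (map (\<lambda>(i, j). \<phi> i j) (letters w))) (rep_Ugl u)"

lemma
  fixes \<phi> :: "'d \<Rightarrow> 'd \<Rightarrow> 'b::complex_algebra_1"
  assumes rels: "\<And>i j k l. \<phi> i j * \<phi> k l - \<phi> k l * \<phi> i j =
    (if j = k then \<phi> i l else 0) - (if i = l then \<phi> k j else 0)"
  shows unital_algebra_hom_Ugl_lift: "unital_algebra_hom (Ugl_lift \<phi>)"
    and Ugl_lift_e: "Ugl_lift \<phi> (gl_e i j) = \<phi> i j"
proof -
  define h where "h = lin_ext (\<lambda>w. prod_list (map (\<lambda>(i, j). \<phi> i j) (letters w)))"
  have h_mult: "h (p * q) = h p * h q" for p q
    unfolding h_def by (rule lin_ext_mult) (simp add: plus_words_def)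
  have h_letter: "h (letter (i, j)) = \<phi> i j" for i j
    by (simp add: h_def scaleC_one)
  have h_rel: "h (gl_relator i j k l) = 0" for i j k l
  proof -
    have "h (gl_relator i j k l) = h (letter (i, j)) * h (letter (k, l))
        - h (letter (k, l)) * h (letter (i, j))
        - ((if j = k then h (letter (i, l)) else 0) - (if i = l then h (letter (k, j)) else 0))"
      unfolding gl_relator_def h_mult[symmetric] by (simp add: h_def lin_ext_diff)
    then show ?thesis by (simp add: h_letter rels)
  qed
  have h_ideal: "h p = 0" if "p \<in> gl_ideal" for p
    using that
  proof induction
    case (rel a i j k l b)
    show ?case by (simp add: h_mult h_rel)
  qed (simp_all add: h_def lin_ext_add)
  have lift: "Ugl_lift \<phi> (abs_Ugl p) = h p" for p
  proof -
    have "rep_Ugl (abs_Ugl p) - p \<in> gl_ideal"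
      using Quotient3_abs_rep[OF Quotient3_Ugl, of "abs_Ugl p"] by (simp only: Ugl.abs_eq_iff)
    from h_ideal[OF this] show ?thesis
      by (simp add: Ugl_lift_def h_def lin_ext_diff)
  qed
  have one: "Ugl_lift \<phi> 1 = 1"
    unfolding one_Ugl.abs_eq lift h_def single_one[symmetric] lin_ext_single
    by (simp add: zero_words_def scaleC_one)
  have add: "Ugl_lift \<phi> (x + y) = Ugl_lift \<phi> x + Ugl_lift \<phi> y" for x y
    by (induct x rule: Ugl.abs_induct, induct y rule: Ugl.abs_induct)
       (simp add: plus_Ugl.abs_eq lift h_def lin_ext_add)
  have mult: "Ugl_lift \<phi> (x * y) = Ugl_lift \<phi> x * Ugl_lift \<phi> y" for x y
    by (induct x rule: Ugl.abs_induct, induct y rule: Ugl.abs_induct)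
       (simp add: times_Ugl.abs_eq lift h_mult)
  have scale: "Ugl_lift \<phi> (c *\<^sub>C x) = c *\<^sub>C Ugl_lift \<phi> x" for c x
    by (induct x rule: Ugl.abs_induct) (simp add: scaleC_Ugl.abs_eq lift h_def lin_ext_scale)
  show "unital_algebra_hom (Ugl_lift \<phi>)"
    by (simp add: unital_algebra_hom_def one add mult scale)
  show "Ugl_lift \<phi> (gl_e i j) = \<phi> i j"
    by (simp add: gl_e.abs_eq lift h_letter)
qed


section \<open>The standard representation\<close>

definition matrix_unit :: "'d::finite \<Rightarrow> 'd \<Rightarrow> complex^'d^'d" where
  "matrix_unit i j = (\<chi> a b. if a = i \<and> b = j then 1 else 0)"

definition rho_word :: "('d::finite \<times> 'd) words \<Rightarrow> complex^'d^'d" where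
  "rho_word w = foldr (\<lambda>(i, j) A. matrix_unit i j ** A) (letters w) (mat 1)"

definition rho_free :: "(('d::finite \<times> 'd) words \<Rightarrow>\<^sub>0 complex) \<Rightarrow> complex^'d^'d" where
  "rho_free p = (\<chi> a b. lin_ext (\<lambda>w. rho_word w $ a $ b) p)"

lemma matrix_unit_mult:
  "matrix_unit i j ** matrix_unit k l = (if j = k then matrix_unit i l else 0)"
proof -
  have "(\<Sum>c\<in>UNIV. (if a = i \<and> c = j then 1 else 0) * (if c = k \<and> b = l then 1 else 0)) =
      (if j = k \<and> a = i \<and> b = l then 1 else (0::complex))" for a b
  proof -
    have "(\<Sum>c\<in>UNIV. (if a = i \<and> c = j then 1 else 0) * (if c = k \<and> b = l then 1 else 0)) =
      (\<Sum>c\<in>UNIV. if c = j then (if j = k \<and> a = i \<and> b = l then 1 else (0::complex)) else 0)"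
      by (rule sum.cong) auto
    then show ?thesis by simp
  qed
  then show ?thesis
    by (simp add: matrix_matrix_mult_def matrix_unit_def vec_eq_iff)
qed

lemma rho_word_append: "rho_word (v + w) = rho_word v ** rho_word w"
proof -
  have "foldr (\<lambda>(i, j) A. matrix_unit i j ** A) as B =
      foldr (\<lambda>(i, j) A. matrix_unit i j ** A) as (mat 1) ** B"
    for as :: "('a \<times> 'a) list" and B
    by (induction as) (auto simp: matrix_mul_assoc)
  then show ?thesis by (simp add: rho_word_def plus_words_def)
qed

lemma rho_free_add: "rho_free (p + q) = rho_free p + rho_free q"
  by (simp add: rho_free_def vec_eq_iff lin_ext_add)

lemma rho_free_diff: "rho_free (p - q) = rho_free p - rho_free q"
  by (simp add: rho_free_def vec_eq_iff lin_ext_diff)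

lemma rho_free_zero: "rho_free 0 = 0"
  by (simp add: rho_free_def vec_eq_iff)

lemma rho_free_mult: "rho_free (p * q) = rho_free p ** rho_free q"
proof (induction p rule: pm_induct)
  case zero
  show ?case by (simp add: rho_free_zero)
next
  case (single m c)
  show ?case
  proof (induction q rule: pm_induct)
    case zero
    show ?case by (simp add: rho_free_zero)
  next
    case (single n c')
    show ?case
      by (simp add: rho_free_def mult_single rho_word_append matrix_matrix_mult_def vec_eq_iff
          sum_distrib_left mult_ac)
  next
    case (add p q)
    then show ?case by (simp add: distrib_left rho_free_add matrix_add_ldistrib)
  qed
next
  case (add p q)
  have "(A + B) ** C = A ** C + B ** C" for A B C :: "complex^'a^'a"
    by (simp add: matrix_matrix_mult_def vec_eq_iff distrib_right sum.distrib)
  with add show ?case by (simp add: distrib_right rho_free_add)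
qed

lemma rho_free_letter: "rho_free (letter (i, j)) = matrix_unit i j"
  by (simp add: rho_free_def rho_word_def vec_eq_iff)

lemma rho_free_ideal: "p \<in> gl_ideal \<Longrightarrow> rho_free p = 0"
proof (induction rule: gl_ideal.induct)
  case (rel a i j k l b)
  have "rho_free (gl_relator i j k l) =
      matrix_unit i j ** matrix_unit k l - matrix_unit k l ** matrix_unit i j
      - ((if j = k then matrix_unit i l else 0) - (if i = l then matrix_unit k j else 0))"
    unfolding rho_free_letter[symmetric] rho_free_mult[symmetric] gl_relator_def
    by (simp add: rho_free_diff rho_free_zero)
  also have "\<dots> = 0" by (auto simp: matrix_unit_mult)
  finally show ?case by (simp add: rho_free_mult)
qed (simp_all add: rho_free_zero rho_free_add)

lift_definition rho :: "'d::finite Ugl \<Rightarrow> complex^'d^'d" is rho_free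
  by (metis rho_free_ideal rho_free_diff eq_iff_diff_eq_0)

lemma rho_e: "rho (gl_e i j) = matrix_unit i j"
  by transfer (rule rho_free_letter)

lemma rho_one: "rho 1 = mat 1"
  by transfer (simp add: rho_free_def rho_word_def zero_words_def vec_eq_iff flip: single_one)

lemma rho_add: "rho (x + y) = rho x + rho y"
  by transfer (rule rho_free_add)

lemma rho_mult: "rho (x * y) = rho x ** rho y"
  by transfer (rule rho_free_mult)

lemma rho_scaleC: "rho (c *\<^sub>C x) = (\<chi> a b. c * rho x $ a $ b)"
  by transfer (simp add: rho_free_def lin_ext_scale)

definition eta :: "'d::finite Ugl \<Rightarrow> complex" where
  "eta x = trace (rho x) / of_nat CARD('d)"

lemma eta_add: "eta (x + y) = eta x + eta y"
  by (simp add: eta_def rho_add trace_add add_divide_distrib)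

lemma eta_scaleC: "eta (c *\<^sub>C x) = c * eta x"
  by (simp add: eta_def rho_scaleC trace_def sum_distrib_left)


section \<open>The tensor product of two algebras\<close>

text \<open>
  The free vector space on \<open>'a \<times> 'b\<close>, modulo the span of the bilinearity relations. The pairs form
  a monoid under componentwise multiplication (again written additively), so the free vector space
  is a monoid algebra, whose product induces \<open>(a \<otimes> b) (a' \<otimes> b') = a a' \<otimes> b b'\<close>.
\<close>

datatype ('a, 'b) tpair = TPair (tfst: 'a) (tsnd: 'b)

instantiation tpair :: (monoid_mult, monoid_mult) monoid_add
begin
definition "0 = TPair 1 1"
definition "x + y = TPair (tfst x * tfst y) (tsnd x * tsnd y)"
instance by standard (simp_all add: zero_tpair_def plus_tpair_def mult.assoc)
end

abbreviation tgen :: "'a \<Rightarrow> 'b \<Rightarrow> ('a, 'b) tpair \<Rightarrow>\<^sub>0 complex" where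
  "tgen a b \<equiv> Poly_Mapping.single (TPair a b) 1"

inductive_set tensor_null ::
  "(('a::complex_algebra_1, 'b::complex_algebra_1) tpair \<Rightarrow>\<^sub>0 complex) set" where
  zero: "0 \<in> tensor_null"
| add_left: "tgen (a + a') b - tgen a b - tgen a' b \<in> tensor_null"
| add_right: "tgen a (b + b') - tgen a b - tgen a b' \<in> tensor_null"
| scale_left: "tgen (c *\<^sub>C a) b - Poly_Mapping.single 0 c * tgen a b \<in> tensor_null"
| scale_right: "tgen a (c *\<^sub>C b) - Poly_Mapping.single 0 c * tgen a b \<in> tensor_null"
| plus: "p \<in> tensor_null \<Longrightarrow> q \<in> tensor_null \<Longrightarrow> p + q \<in> tensor_null"
| smult: "p \<in> tensor_null \<Longrightarrow> Poly_Mapping.single 0 c * p \<in> tensor_null"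

lemma single_conv_tgen:
  "Poly_Mapping.single (TPair a b) c = Poly_Mapping.single 0 c * tgen a b"
  by (simp add: mult_single)

lemma tgen_mult: "tgen a b * tgen a' b' = tgen (a * a') (b * b')"
  by (simp add: mult_single plus_tpair_def)

lemma tensor_null_mult_left:
  assumes "p \<in> tensor_null"
  shows "r * p \<in> tensor_null"
proof (induction r rule: pm_induct)
  case zero
  show ?case by (simp add: tensor_null.zero)
next
  case (single m d)
  obtain x y where m: "m = TPair x y" by (cases m)
  have comm: "tgen x y * (Poly_Mapping.single 0 c * p) = Poly_Mapping.single 0 c * (tgen x y * p)"
    for c p
    by (simp only: mult.assoc[symmetric] single_zero_central)
  have "tgen x y * p \<in> tensor_null"
    using assms
    by induction
       (auto simp: comm right_diff_distrib tgen_mult distrib_left mult_scaleC_right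
          intro: tensor_null.intros)
  then show ?case
    unfolding m single_conv_tgen[of _ _ d] mult.assoc by (rule tensor_null.smult)
next
  case (add p q)
  then show ?case by (simp add: distrib_right tensor_null.plus)
qed

lemma tensor_null_mult_right:
  assumes "p \<in> tensor_null"
  shows "p * r \<in> tensor_null"
proof (induction r rule: pm_induct)
  case zero
  show ?case by (simp add: tensor_null.zero)
next
  case (single m d)
  obtain x y where m: "m = TPair x y" by (cases m)
  have "p * tgen x y \<in> tensor_null"
    using assms
    by induction
       (auto simp: mult.assoc left_diff_distrib tgen_mult distrib_right mult_scaleC_left
          intro: tensor_null.intros)
  then have "Poly_Mapping.single 0 d * (p * tgen x y) \<in> tensor_null"
    by (rule tensor_null.smult)
  then show ?case
    unfolding m single_conv_tgen[of _ _ d] by (simp only: mult.assoc[symmetric] single_zero_central)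
next
  case (add p q)
  then show ?case by (simp add: distrib_left tensor_null.plus)
qed

lemma tensor_null_uminus: "p \<in> tensor_null \<Longrightarrow> - p \<in> tensor_null"
  using tensor_null_mult_left[of p "- 1"] by simp

lemma tensor_null_diff: "p \<in> tensor_null \<Longrightarrow> q \<in> tensor_null \<Longrightarrow> p - q \<in> tensor_null"
  using tensor_null.plus[OF _ tensor_null_uminus] by fastforce

quotient_type (overloaded) ('a, 'b) tensor =
  "('a::complex_algebra_1, 'b::complex_algebra_1) tpair \<Rightarrow>\<^sub>0 complex"
  / "\<lambda>p q. p - q \<in> tensor_null"
proof (rule equivpI)
  show "reflp (\<lambda>p q :: ('a, 'b) tpair \<Rightarrow>\<^sub>0 complex. p - q \<in> tensor_null)"
    by (simp add: reflp_def tensor_null.zero)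
  show "symp (\<lambda>p q :: ('a, 'b) tpair \<Rightarrow>\<^sub>0 complex. p - q \<in> tensor_null)"
  proof (rule sympI)
    fix p q :: "('a, 'b) tpair \<Rightarrow>\<^sub>0 complex"
    assume "p - q \<in> tensor_null"
    from tensor_null_uminus[OF this] show "q - p \<in> tensor_null" by simp
  qed
  show "transp (\<lambda>p q :: ('a, 'b) tpair \<Rightarrow>\<^sub>0 complex. p - q \<in> tensor_null)"
  proof (rule transpI)
    fix p q r :: "('a, 'b) tpair \<Rightarrow>\<^sub>0 complex"
    assume "p - q \<in> tensor_null" "q - r \<in> tensor_null"
    from tensor_null.plus[OF this] show "p - r \<in> tensor_null" by simp
  qed
qed

lift_definition id_tensor_eta ::
  "('a::complex_algebra_1, 'd::finite Ugl) tensor \<Rightarrow> 'a"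
  is "lin_ext (\<lambda>m. eta (tsnd m) *\<^sub>C tfst m)"
proof -
  let ?L = "lin_ext (\<lambda>m :: ('a, 'd Ugl) tpair. eta (tsnd m) *\<^sub>C tfst m)"
  have "?L p = 0" if "p \<in> tensor_null" for p
    using that
    by induction
       (simp_all add: lin_ext_diff lin_ext_add lin_ext_scale scaleC_one scaleC_add_right
          scaleC_add_left scaleC_scaleC eta_add eta_scaleC mult.commute)
  then show "?L p = ?L q" if "p - q \<in> tensor_null" for p q
    using that lin_ext_diff[of _ p q] by (metis eq_iff_diff_eq_0)
qed

lemma unit_functional:
  "\<exists>f. f (1::'a::complex_algebra_1) = 1 \<and> (\<forall>x y. f (x + y) = f x + f y) \<and>
       (\<forall>c x. f (c *\<^sub>C x) = c * (f x :: complex))"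
proof -
  interpret vector_space_pair "scaleC :: complex \<Rightarrow> 'a \<Rightarrow> 'a" "(*) :: complex \<Rightarrow> complex \<Rightarrow> complex"
    by unfold_locales
       (simp_all add: scaleC_add_right scaleC_add_left scaleC_scaleC scaleC_one algebra_simps)
  have "vs1.independent {1 :: 'a}"
    by (simp add: vs1.dependent_single)
  from linear_independent_extend[OF this, of "\<lambda>_. 1"] obtain g where
    g: "Vector_Spaces.linear scaleC (*) g" "g (1::'a) = (1::complex)" by auto
  show ?thesis
    using g(2) linear_add[OF g(1)] linear_scale[OF g(1)] by (intro exI[of _ g]) auto
qed

lemma one_notin_tensor_null:
  "(1 :: ('a::complex_algebra_1, 'b::complex_algebra_1) tpair \<Rightarrow>\<^sub>0 complex) \<notin> tensor_null"
proof
  obtain f :: "'a \<Rightarrow> complex" where f: "f 1 = 1" "\<And>x y. f (x + y) = f x + f y"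
    "\<And>c x. f (c *\<^sub>C x) = c * f x" using unit_functional by blast
  obtain g :: "'b \<Rightarrow> complex" where g: "g 1 = 1" "\<And>x y. g (x + y) = g x + g y"
    "\<And>c x. g (c *\<^sub>C x) = c * g x" using unit_functional by blast
  have null: "lin_ext (\<lambda>m. f (tfst m) * g (tsnd m)) p = 0" if "p \<in> tensor_null" for p
    using that
    by induction (simp_all only: lin_ext_diff lin_ext_add lin_ext_scale lin_ext_single lin_ext_zero
        tpair.sel f g scaleC_complex_def, simp_all add: algebra_simps)
  assume "(1 :: ('a, 'b) tpair \<Rightarrow>\<^sub>0 complex) \<in> tensor_null"
  from null[OF this] show False
    unfolding single_one[symmetric] lin_ext_single by (simp add: zero_tpair_def f g)
qed

instantiation tensor :: (complex_algebra_1, complex_algebra_1) complex_algebra_1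
begin

lift_definition zero_tensor :: "('a, 'b) tensor" is 0 .
lift_definition one_tensor :: "('a, 'b) tensor" is 1 .
lift_definition plus_tensor :: "('a, 'b) tensor \<Rightarrow> ('a, 'b) tensor \<Rightarrow> ('a, 'b) tensor" is "(+)"
  by (metis add_diff_add tensor_null.plus)
lift_definition uminus_tensor :: "('a, 'b) tensor \<Rightarrow> ('a, 'b) tensor" is uminus
  by (metis tensor_null_uminus minus_diff_minus)
lift_definition minus_tensor :: "('a, 'b) tensor \<Rightarrow> ('a, 'b) tensor \<Rightarrow> ('a, 'b) tensor" is "(-)"
proof -
  fix p p' q q' :: "('a, 'b) tpair \<Rightarrow>\<^sub>0 complex"
  assume "p - p' \<in> tensor_null" "q - q' \<in> tensor_null"
  from tensor_null_diff[OF this] show "(p - q) - (p' - q') \<in> tensor_null"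
    by (simp add: algebra_simps)
qed
lift_definition times_tensor :: "('a, 'b) tensor \<Rightarrow> ('a, 'b) tensor \<Rightarrow> ('a, 'b) tensor" is "(*)"
proof -
  fix p p' q q' :: "('a, 'b) tpair \<Rightarrow>\<^sub>0 complex"
  assume "p - p' \<in> tensor_null" "q - q' \<in> tensor_null"
  then have "(p - p') * q + p' * (q - q') \<in> tensor_null"
    by (intro tensor_null.plus tensor_null_mult_left tensor_null_mult_right)
  then show "p * q - p' * q' \<in> tensor_null"
    by (simp add: algebra_simps)
qed
lift_definition scaleC_tensor :: "complex \<Rightarrow> ('a, 'b) tensor \<Rightarrow> ('a, 'b) tensor"
  is "\<lambda>c p. Poly_Mapping.single 0 c * p"
  by (metis tensor_null_mult_left right_diff_distrib)

instance
proof
  have "(0 :: ('a, 'b) tpair \<Rightarrow>\<^sub>0 complex) - 1 \<notin> tensor_null"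
  proof
    assume "(0 :: ('a, 'b) tpair \<Rightarrow>\<^sub>0 complex) - 1 \<in> tensor_null"
    from tensor_null_uminus[OF this] show False by (simp add: one_notin_tensor_null)
  qed
  then show "(0 :: ('a, 'b) tensor) \<noteq> 1"
    by transfer
next
  fix c c' :: complex and x y z :: "('a, 'b) tensor"
  show "x * y * z = x * (y * z)" by transfer (simp add: mult.assoc tensor_null.zero)
  show "1 * x = x" "x * 1 = x" by (transfer; simp add: tensor_null.zero)+
  show "x + y + z = x + (y + z)" by transfer (simp add: add.assoc tensor_null.zero)
  show "x + y = y + x" by transfer (simp add: add.commute tensor_null.zero)
  show "0 + x = x" by transfer (simp add: tensor_null.zero)
  show "- x + x = 0" by transfer (simp add: tensor_null.zero)
  show "x - y = x + - y" by transfer (simp add: tensor_null.zero)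
  show "(x + y) * z = x * z + y * z" by transfer (simp add: distrib_right tensor_null.zero)
  show "x * (y + z) = x * y + x * z" by transfer (simp add: distrib_left tensor_null.zero)
  show "c *\<^sub>C (x + y) = c *\<^sub>C x + c *\<^sub>C y"
    by transfer (simp add: distrib_left tensor_null.zero)
  show "(c + c') *\<^sub>C x = c *\<^sub>C x + c' *\<^sub>C x"
    by transfer (simp add: single_add distrib_right tensor_null.zero)
  show "c *\<^sub>C c' *\<^sub>C x = (c * c') *\<^sub>C x"
    by transfer (simp add: mult_single tensor_null.zero flip: mult.assoc)
  show "1 *\<^sub>C x = x" by transfer (simp add: tensor_null.zero)
  show "(c *\<^sub>C x) * y = c *\<^sub>C (x * y)" by transfer (simp add: mult.assoc tensor_null.zero)
  show "x * (c *\<^sub>C y) = c *\<^sub>C (x * y)"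
  proof transfer
    fix c and p q :: "('a, 'b) tpair \<Rightarrow>\<^sub>0 complex"
    have "p * (Poly_Mapping.single 0 c * q) = Poly_Mapping.single 0 c * (p * q)"
      by (simp only: mult.assoc[symmetric] single_zero_central)
    then show "p * (Poly_Mapping.single 0 c * q) - Poly_Mapping.single 0 c * (p * q) \<in> tensor_null"
      by (simp add: tensor_null.zero)
  qed
qed

end

lift_definition tensor_elem ::
  "'a::complex_algebra_1 \<Rightarrow> 'b::complex_algebra_1 \<Rightarrow> ('a, 'b) tensor"  (infixr "\<otimes>\<^sub>C" 72)
  is tgen .

lemma tensor_elem_add_left: "(a + a') \<otimes>\<^sub>C b = a \<otimes>\<^sub>C b + a' \<otimes>\<^sub>C b"
  by transfer (use tensor_null.add_left in \<open>simp add: algebra_simps\<close>)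

lemma tensor_elem_add_right: "a \<otimes>\<^sub>C (b + b') = a \<otimes>\<^sub>C b + a \<otimes>\<^sub>C b'"
  by transfer (use tensor_null.add_right in \<open>simp add: algebra_simps\<close>)

lemma tensor_elem_scaleC_left: "(c *\<^sub>C a) \<otimes>\<^sub>C b = c *\<^sub>C (a \<otimes>\<^sub>C b)"
  by transfer (rule tensor_null.scale_left)

lemma tensor_elem_scaleC_right: "a \<otimes>\<^sub>C (c *\<^sub>C b) = c *\<^sub>C (a \<otimes>\<^sub>C b)"
  by transfer (rule tensor_null.scale_right)

lemma tensor_elem_mult: "(a \<otimes>\<^sub>C b) * (a' \<otimes>\<^sub>C b') = (a * a') \<otimes>\<^sub>C (b * b')"
  by transfer (simp only: tgen_mult diff_self tensor_null.zero)

lemma tensor_elem_one: "1 \<otimes>\<^sub>C 1 = 1"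
  by transfer (simp add: tensor_null.zero flip: single_one zero_tpair_def)

lemma id_tensor_eta_elem: "id_tensor_eta (a \<otimes>\<^sub>C b) = eta b *\<^sub>C a"
  by transfer (simp add: scaleC_one)

lemma id_tensor_eta_add: "id_tensor_eta (s + t) = id_tensor_eta s + id_tensor_eta t"
  by transfer (rule lin_ext_add)

lemma id_tensor_eta_scaleC: "id_tensor_eta (c *\<^sub>C t) = c *\<^sub>C id_tensor_eta t"
  by transfer (rule lin_ext_scale)


section \<open>The coproduct\<close>

text \<open>
  The simple coroots \<open>h\<^sub>i = e\<^sub>i\<^sub>i - e\<^sub>i\<^sub>+\<^sub>1\<^sub>,\<^sub>i\<^sub>+\<^sub>1\<close> are the differences \<open>gl_e i i - gl_e j j\<close> for \<open>j\<close> the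
  immediate successor of \<open>i\<close>. Note that \<open>I_gl\<close> is group-like and not primitive.
\<close>

definition is_coproduct ::
    "('d::{finite,linorder} Ugl \<Rightarrow> ('d Ugl, 'd Ugl) tensor) \<Rightarrow> bool" where
  "is_coproduct D \<longleftrightarrow> unital_algebra_hom D \<and>
     D I_gl = I_gl \<otimes>\<^sub>C I_gl \<and>
     (\<forall>i j. i \<noteq> j \<longrightarrow> D (gl_e i j) = 1 \<otimes>\<^sub>C gl_e i j + gl_e i j \<otimes>\<^sub>C 1) \<and>
     (\<forall>i j. i < j \<and> {i<..<j} = {} \<longrightarrow>
        D (gl_e i i - gl_e j j) = 1 \<otimes>\<^sub>C (gl_e i i - gl_e j j) + (gl_e i i - gl_e j j) \<otimes>\<^sub>C 1)"

definition Delta :: "'d::{finite,linorder} Ugl \<Rightarrow> ('d Ugl, 'd Ugl) tensor" where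
  "Delta = (THE D. is_coproduct D)"

definition prim :: "'d Ugl \<Rightarrow> ('d Ugl, 'd Ugl) tensor" where
  "prim x = 1 \<otimes>\<^sub>C x + x \<otimes>\<^sub>C 1"

lemma prim_add: "prim (x + y) = prim x + prim y"
  by (simp add: prim_def tensor_elem_add_left tensor_elem_add_right)

lemma prim_scaleC: "prim (c *\<^sub>C x) = c *\<^sub>C prim x"
  by (simp add: prim_def tensor_elem_scaleC_left tensor_elem_scaleC_right scaleC_add_right)

lemma prim_zero: "prim 0 = 0"
  using prim_add[of 0 0] by simp

lemma prim_diff: "prim (x - y) = prim x - prim y"
  using prim_add[of "x - y" y] by simp

lemma prim_uminus: "prim (- x) = - prim x"
  using prim_diff[of 0 x] by (simp add: prim_zero)

lemma prim_sum: "prim (sum f S) = (\<Sum>i\<in>S. prim (f i))"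
  by (induction S rule: infinite_finite_induct) (simp_all add: prim_zero prim_add)

lemma prim_commutator: "prim x * prim y - prim y * prim x = prim (x * y - y * x)"
  by (simp add: prim_diff)
     (simp add: prim_def distrib_left distrib_right tensor_elem_mult)

lemma I_gl_central: "I_gl * u = u * (I_gl :: 'd::finite Ugl)"
  using Ugl_generated[of u]
proof induction
  case (gen x)
  then obtain k l where x: "x = gl_e k l" by auto
  have "I_gl * gl_e k l - gl_e k l * I_gl = (\<Sum>i\<in>UNIV. gl_e i i * gl_e k l - gl_e k l * gl_e i i)"
    by (simp add: I_gl_def sum_distrib_left sum_distrib_right sum_subtractf)
  also have "\<dots> = 0"
    by (simp add: gl_e_commutator sum_subtractf)
  finally show ?case by (simp add: x)
next
  case (times x y)
  then show ?case by (metis mult.assoc)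
qed (simp_all add: mult_scaleC_left mult_scaleC_right distrib_left distrib_right)

definition traceless :: "'d::finite \<Rightarrow> 'd \<Rightarrow> 'd Ugl" where
  "traceless i j = gl_e i j - (if i = j then (1 / of_nat CARD('d)) *\<^sub>C I_gl else 0)"

definition Delta_gen :: "'d::finite \<Rightarrow> 'd \<Rightarrow> ('d Ugl, 'd Ugl) tensor" where
  "Delta_gen i j = prim (traceless i j)
     + (if i = j then (1 / of_nat CARD('d)) *\<^sub>C (I_gl \<otimes>\<^sub>C I_gl) else 0)"

lemma traceless_commutator:
  "traceless i j * traceless k l - traceless k l * traceless i j =
     gl_e i j * gl_e k l - gl_e k l * gl_e i j"
  by (simp add: traceless_def left_diff_distrib right_diff_distrib mult_scaleC_left
      mult_scaleC_right I_gl_central)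

lemma Delta_gen_commutator:
  "Delta_gen i j * Delta_gen k l - Delta_gen k l * Delta_gen i j =
     (if j = k then Delta_gen i l else 0) - (if i = l then Delta_gen k j else 0)"
proof -
  have comm: "prim x * (I_gl \<otimes>\<^sub>C I_gl) = (I_gl \<otimes>\<^sub>C I_gl) * prim x" for x :: "'a Ugl"
    by (simp add: prim_def distrib_left distrib_right tensor_elem_mult I_gl_central)
  have "Delta_gen i j * Delta_gen k l - Delta_gen k l * Delta_gen i j =
      prim (traceless i j) * prim (traceless k l) - prim (traceless k l) * prim (traceless i j)"
    by (simp add: Delta_gen_def distrib_left distrib_right mult_scaleC_left mult_scaleC_right comm)
  also have "\<dots> = prim (gl_e i j * gl_e k l - gl_e k l * gl_e i j)"
    by (simp add: prim_commutator traceless_commutator)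
  also have "\<dots> = (if j = k then Delta_gen i l else 0) - (if i = l then Delta_gen k j else 0)"
    by (cases "j = k"; cases "i = l")
       (auto simp: gl_e_commutator Delta_gen_def traceless_def prim_diff prim_zero prim_uminus)
  finally show ?thesis .
qed

lemma is_coproduct_exists: "is_coproduct (Ugl_lift Delta_gen)"
proof -
  let ?D = "Ugl_lift Delta_gen :: 'a Ugl \<Rightarrow> _"
  have hom: "unital_algebra_hom ?D"
    by (rule unital_algebra_hom_Ugl_lift[OF Delta_gen_commutator])
  have De: "?D (gl_e i j) = Delta_gen i j" for i j
    by (rule Ugl_lift_e[OF Delta_gen_commutator])
  have add: "?D (x + y) = ?D x + ?D y" for x y
    using hom by (simp add: unital_algebra_hom_def)
  have zero: "?D 0 = 0" using add[of 0 0] by simp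
  have diff: "?D (x - y) = ?D x - ?D y" for x y using add[of "x - y" y] by simp
  have sum: "?D (sum f S) = (\<Sum>i\<in>S. ?D (f i))" for f and S :: "'a set"
    by (induction S rule: infinite_finite_induct) (simp_all add: zero add)
  have card: "of_nat CARD('a) *\<^sub>C ((1 / of_nat CARD('a)) *\<^sub>C x) = x"
    for x :: "'b::complex_algebra_1"
    by (simp add: scaleC_scaleC scaleC_one)
  have "?D I_gl = (\<Sum>i\<in>UNIV. Delta_gen i i)"
    by (simp add: I_gl_def sum De)
  also have "\<dots> = prim (\<Sum>i\<in>UNIV. traceless i i) + (I_gl \<otimes>\<^sub>C I_gl)"
    using card[of "I_gl \<otimes>\<^sub>C (I_gl :: 'a Ugl)"]
    by (simp add: Delta_gen_def sum.distrib prim_sum flip: scaleC_of_nat)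
  also have "(\<Sum>i\<in>UNIV. traceless i i) = (0 :: 'a Ugl)"
    using card[of "I_gl :: 'a Ugl"]
    by (simp add: traceless_def sum_subtractf I_gl_def[symmetric] flip: scaleC_of_nat)
  finally have "?D I_gl = I_gl \<otimes>\<^sub>C I_gl" by (simp add: prim_zero)
  moreover have "?D (gl_e i j) = 1 \<otimes>\<^sub>C gl_e i j + gl_e i j \<otimes>\<^sub>C 1" if "i \<noteq> j" for i j
    using that by (simp add: De Delta_gen_def traceless_def prim_def)
  moreover have "?D (gl_e i i - gl_e j j) = 1 \<otimes>\<^sub>C (gl_e i i - gl_e j j) + (gl_e i i - gl_e j j) \<otimes>\<^sub>C 1" for i j
    unfolding prim_def[symmetric]
    by (simp add: diff De Delta_gen_def traceless_def prim_diff)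
  ultimately show ?thesis
    using hom by (simp add: is_coproduct_def)
qed

lemma is_coproduct_unique:
  fixes D D' :: "'d::{finite,linorder} Ugl \<Rightarrow> ('d Ugl, 'd Ugl) tensor"
  assumes D: "is_coproduct D" and D': "is_coproduct D'"
  shows "D = D'"
proof (rule unital_algebra_hom_eqI)
  show hom: "unital_algebra_hom D" "unital_algebra_hom D'"
    using D D' by (auto simp: is_coproduct_def)
  define F where "F x = D x - D' x" for x
  have F_add: "F (x + y) = F x + F y" for x y
    using hom by (simp add: F_def unital_algebra_hom_def)
  have F_zero: "F 0 = 0" using F_add[of 0 0] by simp
  have F_diff: "F (x - y) = F x - F y" for x y using F_add[of "x - y" y] by simp
  have F_sum: "F (sum f S) = (\<Sum>i\<in>S. F (f i))" for f and S :: "'d set"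
    by (induction S rule: infinite_finite_induct) (simp_all add: F_zero F_add)
  have succ: "F (gl_e i i) = F (gl_e j j)" if "i < j" "{i<..<j} = {}" for i j
  proof -
    have "F (gl_e i i - gl_e j j) = 0"
      using D D' that by (simp add: F_def is_coproduct_def)
    then show ?thesis by (simp add: F_diff)
  qed
  have le: "F (gl_e i i) = F (gl_e j j)" if "i < j" for i j
    using that
  proof (induction "card {i<..<j}" arbitrary: i j rule: less_induct)
    case less
    show ?case
    proof (cases "{i<..<j} = {}")
      case True
      then show ?thesis using succ less.prems by blast
    next
      case False
      then obtain k where k: "i < k" "k < j" by auto
      have "card {i<..<k} < card {i<..<j}" "card {k<..<j} < card {i<..<j}"
        using k by (auto intro!: psubset_card_mono)
      then show ?thesis using less.hyps k by metis
    qed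
  qed
  have all: "F (gl_e i i) = F (gl_e j j)" for i j
  proof (cases i j rule: linorder_cases)
    case less
    then show ?thesis by (rule le)
  next
    case equal
    then show ?thesis by simp
  next
    case greater
    then show ?thesis by (rule le[symmetric])
  qed
  have diag: "F (gl_e i i) = 0" for i
  proof -
    have "0 = F I_gl" using D D' by (simp add: F_def is_coproduct_def)
    also have "\<dots> = (\<Sum>j\<in>(UNIV :: 'd set). F (gl_e i i))"
      unfolding I_gl_def F_sum by (rule sum.cong[OF refl all])
    also have "\<dots> = of_nat CARD('d) *\<^sub>C F (gl_e i i)"
      by (simp add: scaleC_of_nat)
    finally have "(1 / of_nat CARD('d)) *\<^sub>C (of_nat CARD('d) *\<^sub>C F (gl_e i i)) = 0"
      by simp
    then show ?thesis by (simp add: scaleC_scaleC scaleC_one)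
  qed
  show "D (gl_e i j) = D' (gl_e i j)" for i j
  proof (cases "i = j")
    case True
    then show ?thesis using diag[of i] by (simp add: F_def)
  next
    case False
    then show ?thesis using D D' by (simp add: is_coproduct_def)
  qed
qed

theorem is_coproduct_Delta: "is_coproduct Delta"
  unfolding Delta_def
  by (rule theI[of is_coproduct "Ugl_lift Delta_gen", OF is_coproduct_exists])
     (rule is_coproduct_unique[OF _ is_coproduct_exists])

definition P_transition :: "'d::{finite,linorder} Ugl \<Rightarrow> 'd Ugl" where
  "P_transition x = id_tensor_eta (Delta x)"

text \<open>
  For a subalgebra \<open>B\<close>, the restriction of the morphisms \<open>j\<^sub>n\<close> to \<open>B\<close> defines a quantum Markov
  process when \<open>P\<close> maps \<open>B\<close> to itself, so that \<open>P\<close> restricts to a transition operator on \<open>B\<close>;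
  the Markov identity \<open>\<omega>(j\<^sub>n(x) \<xi>) = \<omega>(j\<^sub>n\<^sub>-\<^sub>1(P x) \<xi>)\<close> then holds on \<open>B\<close> because it holds on the
  whole enveloping algebra.
\<close>

definition restricts_to_quantum_Markov_process :: "'d::{finite,linorder} Ugl set \<Rightarrow> bool" where
  "restricts_to_quantum_Markov_process B \<longleftrightarrow> P_transition ` B \<subseteq> B"


section \<open>Traces of powers of leading blocks\<close>

text \<open>
  Rows and columns are indexed by \<open>S\<close>; entries of \<open>M\<close> outside \<open>S \<times> S\<close> do not affect the
  entries of the power inside.
\<close>

primrec mat_power :: "'i set \<Rightarrow> ('i \<Rightarrow> 'i \<Rightarrow> 'a::semiring_1) \<Rightarrow> nat \<Rightarrow> 'i \<Rightarrow> 'i \<Rightarrow> 'a" where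
  "mat_power S M 0 = (\<lambda>i j. if i = j then 1 else 0)"
| "mat_power S M (Suc k) = (\<lambda>i j. \<Sum>l\<in>S. M i l * mat_power S M k l j)"

definition mat_Tr :: "'i set \<Rightarrow> ('i \<Rightarrow> 'i \<Rightarrow> 'a::semiring_1) \<Rightarrow> 'a" where
  "mat_Tr S M = (\<Sum>i\<in>S. M i i)"

text \<open>\<open>card {..i}\<close> is the position of \<open>i\<close> in the increasing enumeration of \<open>'d\<close>.\<close>

definition first_indices :: "nat \<Rightarrow> 'd::{finite,linorder} set" where
  "first_indices m = {i. card {..i} \<le> m}"

lemma card_first_indices:
  assumes "m \<le> CARD('d::{finite,linorder})"
  shows "card (first_indices m :: 'd set) = m"
proof -
  define f where "f = (\<lambda>i::'d. card {..i})"
  have mono: "f i < f j" if "i < j" for i j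
    unfolding f_def using that by (intro psubset_card_mono) auto
  have inj: "inj f"
    by (rule linorder_injI) (use mono in \<open>simp add: less_imp_neq\<close>)
  have "range f \<subseteq> {1..CARD('d)}"
  proof
    fix x assume "x \<in> range f"
    then obtain i :: 'd where x: "x = card {..i}" by (auto simp: f_def)
    have "1 \<le> card {..i}" by (simp add: Suc_le_eq card_gt_0_iff)
    moreover have "card {..i} \<le> CARD('d)" by (rule card_mono) auto
    ultimately show "x \<in> {1..CARD('d)}" unfolding x atLeastAtMost_iff ..
  qed
  then have range: "range f = {1..CARD('d)}"
    by (intro card_subset_eq) (simp_all add: card_image[OF inj])
  have "f ` first_indices m = range f \<inter> {..m}"
    by (auto simp: first_indices_def f_def)
  also have "\<dots> = {1..m}"
    using assms by (auto simp: range)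
  finally have "card (f ` first_indices m) = m" by simp
  then show ?thesis
    by (simp add: card_image inj_on_subset[OF inj])
qed

text \<open>
  For the partition of \<open>E\<close> with diagonal blocks of sizes \<open>d - 2, 1, 1\<close>, the block \<open>E\<^sub>1\<^sub>1\<close>, the
  upper left two by two block matrix and \<open>E\<close> are the leading submatrices of size \<open>d - 2\<close>,
  \<open>d - 1\<close> and \<open>d\<close>.
\<close>

definition Tr_E_power :: "nat \<Rightarrow> nat \<Rightarrow> 'd::{finite,linorder} Ugl" where
  "Tr_E_power m k = mat_Tr (first_indices m) (mat_power (first_indices m) gl_e k)"

end

theory Submission
  imports Defs
begin

text \<open>
  Let \<open>S\<close> and \<open>T\<close> be the sets of the first \<open>d - 2\<close> and \<open>d - 1\<close> indices, and let \<open>C\<close> be the trace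
  of \<open>E\<^sup>2\<close>. Under \<open>(id \<otimes> \<rho>) \<circ> \<Delta>\<close>, the trace of the block on \<open>S\<close> and \<open>C\<close> become the matrices
  \<open>(Tr E\<^sub>S - |S| / d) + 1\<^sub>S\<close> and \<open>Z + 2 E\<^sup>t\<close> with \<open>Z = C + d - (1 + 2 I) / d\<close>. Hence, up to an
  element of the algebra \<open>B\<close> of the theorem, \<open>P (Tr E\<^sub>S C\<^sup>2)\<close> is \<open>4 / d\<close> times
  \<open>Q = (\<Sum>k\<in>S. \<Sum>p. e\<^sub>p\<^sub>k e\<^sub>k\<^sub>p)\<close>, a partial trace which, unlike the elements of \<open>B\<close>, does not
  commute with the quadratic Casimir element of the block on \<open>T\<close>. In the adjoint representation
  that Casimir element kills \<open>e\<^sub>q\<^sub>q\<close>, where \<open>q\<close> is the last index, but does not kill \<open>Q e\<^sub>q\<^sub>q\<close>.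
\<close>

section \<open>Commuting traces\<close>

lemma mat_power_commute:
  fixes u :: "'d Ugl"
  assumes "\<And>a b. a \<in> S \<Longrightarrow> b \<in> S \<Longrightarrow> u * gl_e a b = gl_e a b * u"
    and "i \<in> S" "j \<in> S"
  shows "u * mat_power S gl_e k i j = mat_power S gl_e k i j * u"
  using assms(2,3)
proof (induction k arbitrary: i)
  case (Suc k)
  have "u * (gl_e i l * mat_power S gl_e k l j) = gl_e i l * mat_power S gl_e k l j * u"
    if "l \<in> S" for l
    by (metis Suc.IH Suc.prems assms(1) mult.assoc that)
  then show ?case
    by (auto simp: sum_distrib_left sum_distrib_right intro: sum.cong)
qed simp

text \<open>Under the adjoint action of the block on \<open>S\<close>, entries of every power
  transform like the matrix units themselves. Induction on \<open>k\<close>: the commutator is a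
  derivation, so it splits over \<open>gl_e i l * ?M l j\<close>.\<close>

lemma mat_power_gl_e_commutator:
  fixes S :: "'d set"
  assumes "finite S" "a \<in> S" "b \<in> S" "i \<in> S" "j \<in> S"
  shows "gl_e a b * mat_power S gl_e k i j - mat_power S gl_e k i j * gl_e a b =
    (if b = i then mat_power S gl_e k a j else 0) - (if a = j then mat_power S gl_e k i b else 0)"
  using assms(4)
proof (induction k arbitrary: i)
  case (Suc k)
  let ?M = "mat_power S gl_e k"
  have "gl_e a b * mat_power S gl_e (Suc k) i j - mat_power S gl_e (Suc k) i j * gl_e a b =
      (\<Sum>l\<in>S. (gl_e a b * gl_e i l - gl_e i l * gl_e a b) * ?M l j
         + gl_e i l * (gl_e a b * ?M l j - ?M l j * gl_e a b))"
    by (simp add: sum_distrib_left sum_distrib_right algebra_simps flip: sum_subtractf)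
  also have "\<dots> = (\<Sum>l\<in>S. ((if b = i then gl_e a l else 0) - (if a = l then gl_e i b else 0)) * ?M l j
         + gl_e i l * ((if b = l then ?M a j else 0) - (if a = j then ?M l b else 0)))"
    by (intro sum.cong refl) (simp only: Suc.IH gl_e_commutator)
  \<comment> \<open>Both inner terms reduce to \<open>gl_e i b * ?M a j\<close>, one at
    \<open>l = a\<close> and one at \<open>l = b\<close>. As \<open>a\<close> and \<open>b\<close>
    lie in \<open>S\<close>, each occurs exactly once and they cancel.\<close>
  also have "\<dots> = (\<Sum>l\<in>S. (if b = i then gl_e a l * ?M l j else 0)
        - (if l = a then gl_e i b * ?M a j else 0)
        + ((if l = b then gl_e i b * ?M a j else 0) - (if a = j then gl_e i l * ?M l b else 0)))"
    by (intro sum.cong refl) (auto simp: algebra_simps)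
  also have "\<dots> = (if b = i then mat_power S gl_e (Suc k) a j else 0)
      - (if a = j then mat_power S gl_e (Suc k) i b else 0)"
    using assms by (simp add: sum.distrib sum_subtractf)
  finally show ?case .
qed auto

text \<open>On the diagonal the two terms of the commutator both sum to the entry at
  \<open>(a, b)\<close> of the power.\<close>

lemma mat_Tr_power_central:
  fixes S :: "'d set"
  assumes "finite S" "a \<in> S" "b \<in> S"
  shows "mat_Tr S (mat_power S gl_e k) * gl_e a b = gl_e a b * mat_Tr S (mat_power S gl_e k)"
proof -
  have "gl_e a b * mat_Tr S (mat_power S gl_e k) - mat_Tr S (mat_power S gl_e k) * gl_e a b =
      (\<Sum>i\<in>S. gl_e a b * mat_power S gl_e k i i - mat_power S gl_e k i i * gl_e a b)"
    by (simp add: mat_Tr_def sum_distrib_left sum_distrib_right sum_subtractf)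
  also have "\<dots> = (\<Sum>i\<in>S. (if b = i then mat_power S gl_e k a i else 0)
      - (if a = i then mat_power S gl_e k i b else 0))"
    using assms by (intro sum.cong refl mat_power_gl_e_commutator)
  also have "\<dots> = 0"
    using assms by (simp add: sum_subtractf)
  finally show ?thesis by simp
qed

text \<open>The trace over the larger block is central for that block, and the smaller trace is a
  polynomial in its entries.\<close>

lemma mat_Tr_power_commute:
  fixes S :: "'d set"
  assumes "finite T" "S \<subseteq> T"
  shows "mat_Tr T (mat_power T gl_e l) * mat_Tr S (mat_power S gl_e k) =
    mat_Tr S (mat_power S gl_e k) * mat_Tr T (mat_power T gl_e l)"
proof -
  have "mat_Tr T (mat_power T gl_e l) * mat_power S gl_e k i i =
      mat_power S gl_e k i i * mat_Tr T (mat_power T gl_e l)" if "i \<in> S" for i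
    using assms that by (intro mat_power_commute mat_Tr_power_central) auto
  then show ?thesis
    unfolding mat_Tr_def[of S] by (simp add: sum_distrib_left sum_distrib_right)
qed

section \<open>Scalars, commutants and closure of generated subalgebras\<close>

lemma scaleC_diff_left: "(c - c') *\<^sub>C (x::'a::complex_algebra_1) = c *\<^sub>C x - c' *\<^sub>C x"
  using scaleC_add_left[of c "- c'" x] by (simp add: scaleC_minus_left)

lemma scaleC_sum_left: "sum f S *\<^sub>C (x::'a::complex_algebra_1) = (\<Sum>i\<in>S. f i *\<^sub>C x)"
  by (induction S rule: infinite_finite_induct) (simp_all add: scaleC_add_left)

lemma generated_subalgebra_commute:
  assumes "x \<in> generated_subalgebra S" "\<And>y. y \<in> S \<Longrightarrow> u * y = y * u"
  shows "u * x = x * u"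
  using assms(1)
proof induction
  case (times x y)
  then show ?case by (metis mult.assoc)
qed (auto simp: assms(2) mult_scaleC_left mult_scaleC_right distrib_left distrib_right)

lemma generated_subalgebra_scaleC:
  "x \<in> generated_subalgebra S \<Longrightarrow> c *\<^sub>C x \<in> generated_subalgebra S"
  using generated_subalgebra.times[OF generated_subalgebra.const[of c S], of x]
  by (simp add: mult_scaleC_left)

lemma generated_subalgebra_diff:
  "x \<in> generated_subalgebra S \<Longrightarrow> y \<in> generated_subalgebra S \<Longrightarrow> x - y \<in> generated_subalgebra S"
  using generated_subalgebra.plus[OF _ generated_subalgebra_scaleC, of x S y "- 1"]
  by (simp add: scaleC_minus_left scaleC_one)

lemma mat_Tr_power_1: "finite S \<Longrightarrow> mat_Tr S (mat_power S M (Suc 0)) = (\<Sum>i\<in>S. M i i)"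
  by (simp add: mat_Tr_def if_distrib cong: if_cong)

lemma mat_Tr_power_2: "finite S \<Longrightarrow> mat_Tr S (mat_power S M 2) = (\<Sum>i\<in>S. \<Sum>j\<in>S. M i j * M j i)"
  by (simp add: mat_Tr_def numeral_2_eq_2 if_distrib cong: if_cong)

section \<open>The adjoint representation\<close>

text \<open>Linear operators under composition, made a type so that they can be the target of
  \<open>Ugl_lift\<close>, which asks for a \<open>complex_algebra_1\<close>.\<close>

typedef 'i lin_op = "{f :: ('i \<Rightarrow> complex) \<Rightarrow> 'i \<Rightarrow> complex.
    (\<forall>x y. f (\<lambda>i. x i + y i) = (\<lambda>i. f x i + f y i)) \<and>
    (\<forall>c x. f (\<lambda>i. c * x i) = (\<lambda>i. c * f x i))}"
  by (rule exI[of _ "\<lambda>x. x"]) simp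

setup_lifting type_definition_lin_op

lemma Rep_lin_op_add: "Rep_lin_op f (\<lambda>i. x i + y i) = (\<lambda>i. Rep_lin_op f x i + Rep_lin_op f y i)"
  and Rep_lin_op_scale: "Rep_lin_op f (\<lambda>i. c * x i) = (\<lambda>i. c * Rep_lin_op f x i)"
  using Rep_lin_op[of f] by auto

instantiation lin_op :: (type) complex_algebra_1
begin

lift_definition zero_lin_op :: "'a lin_op" is "\<lambda>x i. 0" by simp
lift_definition one_lin_op :: "'a lin_op" is "\<lambda>x. x" by simp
lift_definition plus_lin_op :: "'a lin_op \<Rightarrow> 'a lin_op \<Rightarrow> 'a lin_op" is "\<lambda>f g x i. f x i + g x i"
  by (simp add: algebra_simps)
lift_definition minus_lin_op :: "'a lin_op \<Rightarrow> 'a lin_op \<Rightarrow> 'a lin_op" is "\<lambda>f g x i. f x i - g x i"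
  by (simp add: algebra_simps)
lift_definition uminus_lin_op :: "'a lin_op \<Rightarrow> 'a lin_op" is "\<lambda>f x i. - f x i"
  by simp
lift_definition times_lin_op :: "'a lin_op \<Rightarrow> 'a lin_op \<Rightarrow> 'a lin_op" is "\<lambda>f g x. f (g x)"
  by simp
lift_definition scaleC_lin_op :: "complex \<Rightarrow> 'a lin_op \<Rightarrow> 'a lin_op" is "\<lambda>c f x i. c * f x i"
  by (simp add: algebra_simps)

lemmas lin_op_rep_eqs = zero_lin_op.rep_eq one_lin_op.rep_eq plus_lin_op.rep_eq minus_lin_op.rep_eq
  uminus_lin_op.rep_eq times_lin_op.rep_eq scaleC_lin_op.rep_eq

instance
proof
  show "(0 :: 'a lin_op) \<noteq> 1"
    by transfer (metis zero_neq_one)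
qed (simp_all add: Rep_lin_op_inject[symmetric] lin_op_rep_eqs Rep_lin_op_add Rep_lin_op_scale
    distrib_left distrib_right mult.assoc add.assoc, simp_all add: add.commute)

end

text \<open>With \<open>X\<close> read as a matrix indexed by pairs, this is the commutator of the
  matrix unit at \<open>(i, j)\<close> with \<open>X\<close>.\<close>

lift_definition ad_unit :: "'d \<Rightarrow> 'd \<Rightarrow> ('d \<times> 'd) lin_op" is
  "\<lambda>i j X p. (if fst p = i then X (j, snd p) else 0) - (if snd p = j then X (fst p, i) else 0)"
  by (intro conjI allI ext) (auto simp: right_diff_distrib)

lemma ad_unit_commutator:
  "ad_unit i j * ad_unit k l - ad_unit k l * ad_unit i j =
    (if j = k then ad_unit i l else 0) - (if i = l then ad_unit k j else 0)"
proof (intro Rep_lin_op_inject[THEN iffD1] ext)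
  fix X and p :: "'a \<times> 'a"
  show "Rep_lin_op (ad_unit i j * ad_unit k l - ad_unit k l * ad_unit i j) X p =
    Rep_lin_op ((if j = k then ad_unit i l else 0) - (if i = l then ad_unit k j else 0)) X p"
    by (cases "j = k"; cases "i = l") (auto simp: lin_op_rep_eqs ad_unit.rep_eq)
qed

lemma Rep_lin_op_sum: "Rep_lin_op (sum f S) x a = (\<Sum>i\<in>S. Rep_lin_op (f i) x a)"
  by (induction S rule: infinite_finite_induct) (simp_all add: zero_lin_op.rep_eq plus_lin_op.rep_eq)

section \<open>The transition operator\<close>

text \<open>Keeps the whole matrix where \<open>id_tensor_eta\<close> keeps only its normalized
  trace. Unlike the latter it is multiplicative, so products can be evaluated before the trace is
  taken.\<close>

lift_definition id_tensor_rho ::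
  "('a::complex_algebra_1, 'd::finite Ugl) tensor \<Rightarrow> 'd \<Rightarrow> 'd \<Rightarrow> 'a"
  is "\<lambda>p k l. lin_ext (\<lambda>m. (rho (tsnd m) $ k $ l) *\<^sub>C tfst m) p"
proof (intro ext)
  fix p q :: "('a, 'd Ugl) tpair \<Rightarrow>\<^sub>0 complex" and k l
  let ?L = "lin_ext (\<lambda>m :: ('a, 'd Ugl) tpair. (rho (tsnd m) $ k $ l) *\<^sub>C tfst m)"
  assume "p - q \<in> tensor_null"
  then have "?L (p - q) = 0"
    by induction
       (simp_all add: lin_ext_diff lin_ext_add lin_ext_scale scaleC_one scaleC_add_right
          scaleC_add_left scaleC_scaleC rho_add rho_scaleC mult.commute)
  then show "?L p = ?L q"
    by (simp add: lin_ext_diff)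
qed

lemma id_tensor_rho_elem: "id_tensor_rho (a \<otimes>\<^sub>C b) k l = (rho b $ k $ l) *\<^sub>C a"
  by transfer (simp add: scaleC_one)

lemma id_tensor_rho_add: "id_tensor_rho (s + t) k l = id_tensor_rho s k l + id_tensor_rho t k l"
  by transfer (rule lin_ext_add)

lemma id_tensor_rho_scaleC: "id_tensor_rho (c *\<^sub>C t) k l = c *\<^sub>C id_tensor_rho t k l"
  by transfer (rule lin_ext_scale)

lemma id_tensor_rho_zero: "id_tensor_rho 0 k l = 0"
  by transfer simp

lemma id_tensor_rho_mult:
  fixes s t :: "('b::complex_algebra_1, 'a::finite Ugl) tensor"
  shows "id_tensor_rho (s * t) k l = (\<Sum>j\<in>UNIV. id_tensor_rho s k j * id_tensor_rho t j l)"
proof transfer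
  fix p q :: "('b, 'a Ugl) tpair \<Rightarrow>\<^sub>0 complex" and k l
  let ?L = "\<lambda>k l. lin_ext (\<lambda>m :: ('b, 'a Ugl) tpair. (rho (tsnd m) $ k $ l) *\<^sub>C tfst m)"
  show "?L k l (p * q) = (\<Sum>j\<in>UNIV. ?L k j p * ?L j l q)"
  proof (induction p rule: pm_induct)
    case (single m c)
    show ?case
    proof (induction q rule: pm_induct)
      case (single n c')
      show ?case
        by (simp add: scaleC_sum_left scaleC_sum_right mult_single plus_tpair_def rho_mult
            matrix_matrix_mult_def scaleC_scaleC mult_scaleC_left mult_scaleC_right sum_distrib_left mult_ac)
    qed (simp_all add: distrib_left lin_ext_add sum.distrib)
  qed (simp_all add: distrib_right lin_ext_add sum.distrib)
qed

lemma id_tensor_eta_eq: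
  "id_tensor_eta t = (1 / of_nat CARD('d::finite)) *\<^sub>C
     (\<Sum>k\<in>UNIV. id_tensor_rho (t :: ('a::complex_algebra_1, 'd Ugl) tensor) k k)"
proof transfer
  fix p :: "('a, 'd Ugl) tpair \<Rightarrow>\<^sub>0 complex"
  show "lin_ext (\<lambda>m. eta (tsnd m) *\<^sub>C tfst m) p = (1 / of_nat CARD('d)) *\<^sub>C
      (\<Sum>k\<in>UNIV. lin_ext (\<lambda>m. (rho (tsnd m) $ k $ k) *\<^sub>C tfst m) p)"
  proof (induction p rule: pm_induct)
    case (single m c)
    show ?case
      by (simp add: eta_def trace_def scaleC_scaleC scaleC_sum_left sum_divide_distrib sum_distrib_left
          scaleC_sum_right mult_ac)
  qed (simp_all add: lin_ext_add sum.distrib scaleC_add_right)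
qed

text \<open>Gives \<open>Delta\<close> on each single diagonal \<open>gl_e i i\<close>, where the
  defining conditions only speak of differences and of \<open>I_gl\<close>.\<close>

lemma Delta_eq: "Delta = Ugl_lift Delta_gen"
  by (rule is_coproduct_unique[OF is_coproduct_Delta is_coproduct_exists])

lemma rho_I_gl: "rho I_gl = mat 1"
proof -
  have zero: "rho 0 = (0 :: complex^'a^'a)"
    using rho_add[of 0 "0 :: 'a Ugl"] by simp
  have "rho (sum f S) = (\<Sum>i\<in>S. rho (f i))" for f :: "'a \<Rightarrow> 'a Ugl" and S
    by (induction S rule: infinite_finite_induct) (simp_all add: zero rho_add)
  then have "rho I_gl = (\<Sum>i\<in>UNIV. matrix_unit i (i::'a))"
    by (simp add: I_gl_def rho_e)
  then show ?thesis
    by (auto simp: vec_eq_iff matrix_unit_def mat_def intro!: sum.neutral)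
qed

lemma unital_algebra_hom_Delta: "unital_algebra_hom Delta"
  using is_coproduct_Delta unfolding is_coproduct_def by blast

text \<open>An algebra homomorphism into matrices over the enveloping algebra;
  \<open>P_transition\<close> is its normalized trace.\<close>

definition matrix_Delta :: "'d::{finite,linorder} Ugl \<Rightarrow> 'd \<Rightarrow> 'd \<Rightarrow> 'd Ugl" where
  "matrix_Delta x = id_tensor_rho (Delta x)"

lemma matrix_Delta_add: "matrix_Delta (x + y) k l = matrix_Delta x k l + matrix_Delta y k l"
  by (simp add: matrix_Delta_def unital_algebra_hom_Delta[unfolded unital_algebra_hom_def]
      id_tensor_rho_add)

lemma matrix_Delta_mult:
  "matrix_Delta (x * y) k l = (\<Sum>p\<in>UNIV. matrix_Delta x k p * matrix_Delta y p l)"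
  by (simp add: matrix_Delta_def unital_algebra_hom_Delta[unfolded unital_algebra_hom_def]
      id_tensor_rho_mult)

lemma matrix_Delta_sum: "matrix_Delta (sum f S) k l = (\<Sum>i\<in>S. matrix_Delta (f i) k l)"
proof -
  have "matrix_Delta 0 k l = 0"
    using matrix_Delta_add[of 0 0 k l] by simp
  then show ?thesis
    by (induction S rule: infinite_finite_induct) (simp_all add: matrix_Delta_add)
qed

definition inv_dim :: "'d::finite Ugl" where
  "inv_dim = (1 / of_nat CARD('d)) *\<^sub>C 1"

text \<open>The shift is the trace left by the group-like \<open>I_gl\<close>: in the image of
  \<open>Delta_gen i i\<close> the terms with \<open>I_gl\<close> in the first factor cancel, and
  the traceless part of the second factor contributes the scalar \<open>- 1 / d\<close>.\<close>

definition shifted_e :: "'d::finite \<Rightarrow> 'd \<Rightarrow> 'd Ugl" where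
  "shifted_e i j = gl_e i j - (if i = j then inv_dim else 0)"

lemma matrix_Delta_e:
  "matrix_Delta (gl_e i j) k l =
    (if k = l then shifted_e i j else 0) + (if k = i \<and> l = j then 1 else 0)"
proof -
  have rho_diff: "rho (x - y) = rho x - rho y" for x y :: "'a Ugl"
    using rho_add[of "x - y" y] by simp
  have "Delta (gl_e i j) = Delta_gen i j"
    unfolding Delta_eq by (rule Ugl_lift_e[OF Delta_gen_commutator])
  then have *: "matrix_Delta (gl_e i j) k l = id_tensor_rho (Delta_gen i j) k l"
    by (simp add: matrix_Delta_def)
  show ?thesis
    unfolding * Delta_gen_def prim_def traceless_def shifted_e_def inv_dim_def
    by (cases "i = j"; cases "k = l")
       (auto simp: id_tensor_rho_add id_tensor_rho_elem id_tensor_rho_scaleC id_tensor_rho_zero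
         rho_one rho_e rho_diff rho_scaleC rho_I_gl mat_def matrix_unit_def scaleC_one scaleC_minus_left
         scaleC_diff_left scaleC_diff_right)
qed

lemma P_transition_eq:
  "P_transition (x :: 'd Ugl) =
    (1 / of_nat CARD('d::{finite,linorder})) *\<^sub>C (\<Sum>k\<in>UNIV. matrix_Delta x k k)"
  by (simp add: P_transition_def id_tensor_eta_eq matrix_Delta_def)

lemma matrix_Delta_trace:
  "matrix_Delta (\<Sum>i\<in>S. gl_e i i) k l =
    (if k = l then (\<Sum>i\<in>S. shifted_e i i) + (if k \<in> S then 1 else 0) else 0)"
  by (auto simp: matrix_Delta_sum matrix_Delta_e sum.distrib intro!: sum.neutral)

text \<open>Expanding the product of two images gives a scalar term, two equal cross terms with
  transposed indices, and products of matrix units that sum to \<open>d\<close> times the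
  identity.\<close>

lemma matrix_Delta_casimir:
  fixes k l :: "'d::{finite,linorder}"
  shows "matrix_Delta (\<Sum>i\<in>UNIV. \<Sum>j\<in>UNIV. gl_e i j * gl_e j i) k l =
    (if k = l then (\<Sum>i\<in>UNIV. \<Sum>j\<in>UNIV. shifted_e i j * shifted_e j i) + of_nat CARD('d) else 0)
      + 2 * shifted_e l k"
proof -
  have "(\<Sum>p\<in>UNIV. matrix_Delta (gl_e i j) k p * matrix_Delta (gl_e j i) p l) =
      (if k = l then shifted_e i j * shifted_e j i else 0)
      + (if j = k then if i = l then shifted_e l k else 0 else 0)
      + (if j = l then if i = k then shifted_e l k else 0 else 0)
      + (if i = k then if k = l then 1 else 0 else 0)" for i j
  proof -
    have "(\<Sum>p\<in>UNIV. matrix_Delta (gl_e i j) k p * matrix_Delta (gl_e j i) p l) =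
      (\<Sum>p\<in>UNIV. (if p = k then if k = l then shifted_e i j * shifted_e j i else 0 else 0)
      + (if p = k then if j = k then if i = l then shifted_e l k else 0 else 0 else 0)
      + (if p = l then if j = l then if i = k then shifted_e l k else 0 else 0 else 0)
      + (if p = j then if i = k then if k = l then 1 else 0 else 0 else 0))"
      by (rule sum.cong) (auto simp: matrix_Delta_e distrib_left distrib_right)
    then show ?thesis by (simp add: sum.distrib)
  qed
  then show ?thesis
    by (auto simp: matrix_Delta_sum matrix_Delta_mult sum.distrib mult_2 simp flip: sum_distrib_left)
qed

section \<open>A partial trace forced into the algebra\<close>

lemma generated_subalgebra_of_nat: "of_nat n \<in> generated_subalgebra S"
  using generated_subalgebra.const[of "of_nat n" S] by (simp add: scaleC_of_nat)

lemma generated_subalgebra_numeral: "numeral n \<in> generated_subalgebra S"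
  using generated_subalgebra_of_nat[of "numeral n" S] by simp

text \<open>The factor \<open>T\<close> contributes the indicator of \<open>S\<close>, which cuts
  the matrix trace down to \<open>S\<close>. The square of \<open>C\<close> is taken because
  \<open>C\<close> alone would give only the sum of \<open>gl_e k k\<close> over \<open>S\<close>,
  which is \<open>T\<close> again.\<close>

lemma P_transition_witness:
  fixes S :: "'d::{finite,linorder} set" and G :: "'d Ugl set"
  defines "T \<equiv> \<Sum>i\<in>S. gl_e i i" and "C \<equiv> \<Sum>i\<in>UNIV. \<Sum>j\<in>UNIV. gl_e i j * gl_e j i"
  assumes T: "T \<in> generated_subalgebra G" and I: "I_gl \<in> generated_subalgebra G"
    and C: "C \<in> generated_subalgebra G"
    and P: "P_transition (T * (C * C)) \<in> generated_subalgebra G"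
  shows "(\<Sum>k\<in>S. \<Sum>p\<in>UNIV. gl_e p k * gl_e k p) \<in> generated_subalgebra G"
proof -
  let ?B = "generated_subalgebra G"
  note B = generated_subalgebra.intros(3,4) generated_subalgebra_diff generated_subalgebra_of_nat
    generated_subalgebra_numeral generated_subalgebra_scaleC
  define F where "F = (\<Sum>i\<in>UNIV. \<Sum>j\<in>UNIV. shifted_e i j * shifted_e j (i::'d))"
  \<comment> \<open>The last summand absorbs the diagonal shift in \<open>2 * shifted_e l k\<close>,
    so that the image of \<open>C\<close> becomes \<open>Z\<close> plus twice the transpose of
    \<open>E\<close>.\<close>
  define Z where "Z = F + of_nat CARD('d) - 2 * inv_dim"
  define T' where "T' = (\<Sum>i\<in>S. shifted_e i i)"
  define Q where "Q k = (\<Sum>p\<in>UNIV. gl_e p k * gl_e k (p::'d))" for k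
  define V where "V k = Z * Z + 2 * (Z * gl_e k k) + 2 * (gl_e k k * Z) + 4 * Q k" for k
  have r: "inv_dim \<in> ?B"
    unfolding inv_dim_def by (rule generated_subalgebra.const)
  have "F = (\<Sum>i\<in>UNIV. \<Sum>j\<in>UNIV. gl_e i j * gl_e j i
      - (if j = i then inv_dim * gl_e i i + gl_e i i * inv_dim - inv_dim * inv_dim else 0))"
    unfolding F_def by (intro sum.cong refl) (auto simp: shifted_e_def algebra_simps)
  also have "\<dots> = C - (inv_dim * I_gl + I_gl * inv_dim - of_nat CARD('d) * (inv_dim * inv_dim))"
    by (simp add: C_def sum.distrib sum_subtractf I_gl_def sum_distrib_left sum_distrib_right)
  finally have Z: "Z \<in> ?B"
    unfolding Z_def by (auto intro!: B C I r)
  have "T' = T - of_nat (card S) * inv_dim"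
    by (simp add: T'_def T_def shifted_e_def sum_subtractf)
  then have T': "T' \<in> ?B"
    by (auto intro!: B T r)
  have four: "4 * u = u + u + (u + u)" for u :: "'d Ugl"
    using distrib_right[of 2 2 u] by (simp add: mult_2)
  have D: "matrix_Delta C k l = (if k = l then Z else 0) + 2 * gl_e l k" for k l
    by (auto simp: C_def matrix_Delta_casimir Z_def F_def shifted_e_def right_diff_distrib)
  have "matrix_Delta (C * C) k k = V k" for k
  proof -
    have "matrix_Delta (C * C) k k = (\<Sum>p\<in>UNIV.
        (if p = k then Z * Z + 2 * (Z * gl_e k k) + 2 * (gl_e k k * Z) else 0)
        + 4 * (gl_e p k * gl_e k p))"
      unfolding matrix_Delta_mult D
      by (intro sum.cong refl) (auto simp: four mult_2 mult_2_right distrib_left distrib_right)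
    then show ?thesis
      by (simp add: V_def Q_def sum.distrib sum_distrib_left)
  qed
  moreover have "matrix_Delta T k l = (if l = k then T' + (if k \<in> S then 1 else 0) else 0)" for k l
    by (auto simp: T_def matrix_Delta_trace T'_def)
  ultimately have "matrix_Delta (T * (C * C)) k k = (T' + (if k \<in> S then 1 else 0)) * V k" for k
    by (simp add: matrix_Delta_mult[of T] if_distrib[of "\<lambda>x. x * _"] cong: if_cong)
  then have "(\<Sum>k\<in>UNIV. matrix_Delta (T * (C * C)) k k) =
      (\<Sum>k\<in>UNIV. (T' + (if k \<in> S then 1 else 0)) * V k)"
    by simp
  \<comment> \<open>The scalar \<open>T'\<close> multiplies the full trace, the indicator leaves the
    trace over \<open>S\<close>.\<close>
  also have "\<dots> = T' * sum V UNIV + sum V S"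
    by (simp add: distrib_right sum.distrib sum_distrib_left if_distrib[of "\<lambda>x. x * _"]
        cong: if_cong flip: sum.inter_filter)
  finally have *: "of_nat CARD('d) *\<^sub>C P_transition (T * (C * C)) = T' * sum V UNIV + sum V S"
    by (simp add: P_transition_eq scaleC_scaleC scaleC_one)
  have V: "sum V A = of_nat (card A) * (Z * Z) + 2 * (Z * (\<Sum>k\<in>A. gl_e k k))
      + 2 * ((\<Sum>k\<in>A. gl_e k k) * Z) + 4 * sum Q A" for A
    by (simp add: V_def sum.distrib sum_distrib_left sum_distrib_right)
  \<comment> \<open>Over all indices the quadratic terms add up to \<open>C\<close>, so the full
    trace stays in the algebra and the identity can be solved for \<open>sum Q S\<close>.\<close>
  have "sum Q UNIV = C"
    unfolding Q_def C_def by (rule sum.swap)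
  then have VU: "sum V UNIV \<in> ?B"
    unfolding V I_gl_def[symmetric] by (simp add: B Z C I)
  have "4 * sum Q S = of_nat CARD('d) *\<^sub>C P_transition (T * (C * C)) - T' * sum V UNIV
      - (of_nat (card S) * (Z * Z) + 2 * (Z * T) + 2 * (T * Z))"
    unfolding * V[of S] T_def[symmetric] by simp
  also have "\<dots> \<in> ?B"
    by (intro B P T' VU Z T)
  finally have "(1 / 4) *\<^sub>C (4 * sum Q S) \<in> ?B"
    by (rule generated_subalgebra_scaleC)
  moreover have "4 * sum Q S = 4 *\<^sub>C sum Q S"
    using scaleC_of_nat[of 4 "sum Q S"] by simp
  ultimately show ?thesis
    by (simp add: scaleC_scaleC scaleC_one Q_def)
qed

section \<open>Noncommutation detected in the adjoint representation\<close>

lemma casimir_not_commute: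
  fixes S T :: "'d::finite set"
  assumes "S \<noteq> {}" "S \<subseteq> T" "p \<in> T" "p \<notin> S" "q \<notin> T"
  defines "Q \<equiv> \<Sum>k\<in>S. \<Sum>p\<in>UNIV. gl_e p k * gl_e k p"
    and "C \<equiv> \<Sum>i\<in>T. \<Sum>j\<in>T. gl_e i j * gl_e j i"
  shows "C * Q \<noteq> Q * C"
proof
  assume eq: "C * Q = Q * C"
  define h :: "'d Ugl \<Rightarrow> ('d \<times> 'd) lin_op" where "h = Ugl_lift ad_unit"
  have hom: "unital_algebra_hom h"
    unfolding h_def by (rule unital_algebra_hom_Ugl_lift[OF ad_unit_commutator])
  have h_e: "h (gl_e i j) = ad_unit i j" for i j
    unfolding h_def by (rule Ugl_lift_e[OF ad_unit_commutator])
  have add: "h (x + y) = h x + h y" and mult: "h (x * y) = h x * h y" for x y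
    using hom by (auto simp: unital_algebra_hom_def)
  have "h 0 = 0" using add[of 0 0] by simp
  then have sum: "h (sum f A) = (\<Sum>i\<in>A. h (f i))" for f and A :: "'d set"
    by (induction A rule: infinite_finite_induct) (simp_all add: add)
  note h = h_e mult sum Rep_lin_op_sum times_lin_op.rep_eq
  define v :: "'d \<times> 'd \<Rightarrow> complex" where "v = (\<lambda>x. if x = (q, q) then 1 else 0)"
  \<comment> \<open>The diagonal of \<open>Q v\<close>: for \<open>k\<close> in \<open>S\<close>
    only \<open>i = q\<close> contributes, and
    \<open>[e_qk, [e_kq, e_qq]] = e_qq - e_kk\<close>.\<close>
  define y :: "'d \<Rightarrow> complex" where
    "y a = (if a = q then of_nat (card S) else 0) - (if a \<in> S then 1 else 0)" for a
  have Cv: "Rep_lin_op (h C) v = (\<lambda>x. 0)"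
  proof
    fix x
    \<comment> \<open>Since \<open>q\<close> lies outside \<open>T\<close>, the matrix
      \<open>v\<close> commutes with the block on \<open>T\<close>.\<close>
    have "Rep_lin_op (ad_unit j i) v = (\<lambda>x. 0)" if "i \<in> T" "j \<in> T" for i j
      using that assms by (auto simp: ad_unit.rep_eq v_def fun_eq_iff)
    moreover have "Rep_lin_op f (\<lambda>x. 0) = (\<lambda>x. 0)" for f :: "('d \<times> 'd) lin_op"
      using Rep_lin_op_scale[of f 0 "\<lambda>x. 0"] by simp
    ultimately show "Rep_lin_op (h C) v x = 0"
      by (simp add: C_def h)
  qed
  have Qv: "Rep_lin_op (h Q) v = (\<lambda>x. if fst x = snd x then y (fst x) else 0)"
  proof
    fix x
    have "Rep_lin_op (ad_unit i k) (Rep_lin_op (ad_unit k i) v) x =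
        (if i = q then (if x = (q, q) then 1 else 0) - (if x = (k, k) then 1 else 0) else 0)"
      if "k \<in> S" for i k
    proof -
      have "k \<noteq> q" using that assms by auto
      then have "Rep_lin_op (ad_unit k i) v = (\<lambda>x. if i = q \<and> x = (k, q) then 1 else 0)"
        by (auto simp: ad_unit.rep_eq v_def fun_eq_iff)
      with \<open>k \<noteq> q\<close> show ?thesis
        by (cases x) (auto simp: ad_unit.rep_eq)
    qed
    then have "Rep_lin_op (h Q) v x =
        (\<Sum>k\<in>S. (if x = (q, q) then 1 else 0) - (if x = (k, k) then 1 else 0))"
      by (simp add: Q_def h)
    also have "\<dots> = (if fst x = snd x then y (fst x) else 0)"
      by (cases x) (auto simp: y_def sum_subtractf intro!: sum.neutral)
    finally show "Rep_lin_op (h Q) v x = (if fst x = snd x then y (fst x) else 0)" .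
  qed
  \<comment> \<open>On a diagonal matrix \<open>y\<close> the double commutator with
    \<open>e_ji\<close> and then \<open>e_ij\<close> is
    \<open>(y i - y j) (e_ii - e_jj)\<close>.\<close>
  have "Rep_lin_op (h C) (Rep_lin_op (h Q) v) (p, p) =
      (\<Sum>i\<in>T. \<Sum>j\<in>T. (y i - y j) * ((if i = p then 1 else 0) - (if j = p then 1 else 0)))"
    unfolding C_def h Qv
    by (intro sum.cong refl) (auto simp: ad_unit.rep_eq)
  also have "\<dots> = (\<Sum>i\<in>T. \<Sum>j\<in>T. if i = p then y p - y j else 0)
      + (\<Sum>i\<in>T. \<Sum>j\<in>T. if j = p then y p - y i else 0)"
    by (simp only: sum.distrib[symmetric], intro sum.cong refl) auto
  also have "\<dots> = 2 * (\<Sum>j\<in>T. y p - y j)"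
    using assms by (subst sum.swap) simp
  \<comment> \<open>On \<open>T\<close> the diagonal \<open>y\<close> is \<open>-1\<close> on
    \<open>S\<close> and \<open>0\<close> elsewhere, in particular at \<open>p\<close>, so the entry
    is \<open>2 * card S\<close>.\<close>
  also have "(\<Sum>j\<in>T. y p - y j) = (\<Sum>j\<in>T. if j \<in> S then 1 else 0)"
    using assms by (intro sum.cong refl) (auto simp: y_def)
  also have "\<dots> = of_nat (card S)"
    using assms by (simp add: Int_absorb1 flip: sum.inter_restrict)
  finally have "Rep_lin_op (h (C * Q)) v (p, p) \<noteq> 0"
    using assms by (simp add: mult times_lin_op.rep_eq)
  moreover have "Rep_lin_op (h (Q * C)) v (p, p) = 0"
    using Rep_lin_op_scale[of "h Q" 0 "\<lambda>x. 0"] by (simp add: mult times_lin_op.rep_eq Cv)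
  ultimately show False using eq by simp
qed

theorem theorem4p9:
  assumes "CARD('d::{finite,linorder}) \<ge> 3"
  shows "\<not> restricts_to_quantum_Markov_process
           (generated_subalgebra
             (range (Tr_E_power (CARD('d) - 2)) \<union>
              range (Tr_E_power (CARD('d) - 1)) \<union>
              range (Tr_E_power (CARD('d)))) :: 'd Ugl set)"
proof
  define S T :: "'d set" where "S = first_indices (CARD('d) - 2)" and "T = first_indices (CARD('d) - 1)"
  define G :: "'d Ugl set" where "G = range (Tr_E_power (CARD('d) - 2)) \<union>
    range (Tr_E_power (CARD('d) - 1)) \<union> range (Tr_E_power (CARD('d)))"
  assume "restricts_to_quantum_Markov_process
           (generated_subalgebra
             (range (Tr_E_power (CARD('d) - 2)) \<union>
              range (Tr_E_power (CARD('d) - 1)) \<union>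
              range (Tr_E_power (CARD('d)))) :: 'd Ugl set)"
  then have P: "P_transition x \<in> generated_subalgebra G" if "x \<in> generated_subalgebra G" for x
    using that unfolding restricts_to_quantum_Markov_process_def G_def by blast
  have card: "card S = CARD('d) - 2" "card T = CARD('d) - 1"
    unfolding S_def T_def by (rule card_first_indices; simp)+
  have U: "first_indices CARD('d) = (UNIV :: 'd set)"
    by (rule card_subset_eq) (simp_all add: card_first_indices)
  have sub: "S \<subseteq> T"
    unfolding S_def T_def first_indices_def by auto
  \<comment> \<open>Here \<open>d \<ge> 3\<close> gives \<open>d - 2 \<ge> 1\<close>.\<close>
  have "S \<noteq> {}" using card(1) assms by auto
  have "S \<noteq> T" using card assms by auto
  then obtain p where p: "p \<in> T" "p \<notin> S" using sub by auto
  have "T \<noteq> UNIV" using card assms by auto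
  then obtain q where q: "q \<notin> T" by auto
  have G: "mat_Tr S (mat_power S gl_e k) \<in> generated_subalgebra G"
    "mat_Tr UNIV (mat_power UNIV gl_e k) \<in> generated_subalgebra G" for k
    by (rule generated_subalgebra.gen; auto simp: G_def Tr_E_power_def S_def U)+
  have "(\<Sum>k\<in>S. \<Sum>p\<in>UNIV. gl_e p k * gl_e k p) \<in> generated_subalgebra G"
    using G(1)[of "Suc 0"] G(2)[of "Suc 0"] G(2)[of 2]
    by (intro P_transition_witness P generated_subalgebra.times)
       (simp_all add: mat_Tr_power_1 mat_Tr_power_2 I_gl_def del: mat_power.simps)
  then have "mat_Tr T (mat_power T gl_e 2) * (\<Sum>k\<in>S. \<Sum>p\<in>UNIV. gl_e p k * gl_e k p) =
      (\<Sum>k\<in>S. \<Sum>p\<in>UNIV. gl_e p k * gl_e k p) * mat_Tr T (mat_power T gl_e 2)"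
  proof (rule generated_subalgebra_commute)
    fix y assume "y \<in> G"
    then obtain R k where "y = mat_Tr R (mat_power R gl_e k)" "R \<in> {S, T, UNIV}"
      by (auto simp: G_def Tr_E_power_def S_def T_def U)
    \<comment> \<open>The three index sets form a chain, so \<open>R\<close> is contained in
      \<open>T\<close> or contains it; each case uses centrality of the trace over the larger
      set.\<close>
    then show "mat_Tr T (mat_power T gl_e 2) * y = y * mat_Tr T (mat_power T gl_e 2)"
      using mat_Tr_power_commute[of T R 2 k] mat_Tr_power_commute[of R T k 2] sub by auto
  qed
  then show False
    using casimir_not_commute[OF \<open>S \<noteq> {}\<close> sub p q] by (simp add: mat_Tr_power_2)
qed

end
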